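(* Let $N_r\ge N_t\ge 2$, let $\mathbf{H}\in\mathbb{C}^{N_r\times N_t}$ have full column rank, and let $\mathbf{H}=\mathbf{Q}\mathbf{L}$ be its thin QL decomposition. Fix a puncturing order $1\le\nu\le N_t-1$ and partition $$\mathbf{L}=\begin{bmatrix}\mathbf{P}&\mathbf{0}\\ \mathbf{R}&\mathbf{S}\end{bmatrix},$$ with $\mathbf{P}\in\mathbb{C}^{\nu\times\nu}$ and $\mathbf{S}\in\mathbb{C}^{(N_t-\nu)\times(N_t-\nu)}$. Define $$\boldsymbol{\Sigma}=\operatorname{diag}(\mathbf{S}^{-1}\mathbf{S}^{-\dagger})^{-1/2},\qquad \mathbf{W}_{\mathrm p}=\begin{bmatrix}\mathbf{I}_\nu&\mathbf{0}\\ \mathbf{0}&\boldsymbol{\Sigma}\mathbf{S}^{-1}\end{bmatrix},\qquad \mathbf{L}_{\mathrm p}=\mathbf{W}_{\mathrm p}\mathbf{L}.$$ Let $$\mathbf{F}_{\mathrm p}=\tfrac{1}{N_0}\mathbf{Q}\mathbf{W}_{\mathrm p}^\dagger\mathbf{L}_{\mathrm p},\qquad \mathbf{G}_{\mathrm p}=\tfrac{1}{N_0}\mathbf{L}_{\mathrm p}^\dagger\mathbf{L}_{\mathrm p},$$ and define the mismatched detection model $$p_{\mathrm p}(\mathbf{y}|\mathbf{x})=\exp\big(2\,\mathrm{Re}\{\mathbf{y}^\dagger\mathbf{F}_{\mathrm p}\mathbf{x}\}-\mathbf{x}^\dagger\mathbf{G}_{\mathrm p}\mathbf{x}\big)$$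 together with $$p_{\mathrm p}(\mathbf{y})=\int p_{\mathrm p}(\mathbf{y}|\mathbf{x})\,p(\mathbf{x})\,d\mathbf{x}.$$ Assume $\mathbf{x}\sim\mathcal{CN}(\mathbf{0},E_s\mathbf{I}_{N_t})$ with prior density $p(\mathbf{x})$, let $\mathbf{y}=\mathbf{H}\mathbf{x}+\mathbf{z}$ with $\mathbf{z}\sim\mathcal{CN}(\mathbf{0},N_0\mathbf{I}_{N_r})$ independent of $\mathbf{x}$, and set $\beta=E_s/N_0$. Then the lower bound on the achievable information rate of the WLD detector, $$I_{\mathrm{LB}}^{\mathrm{WLD}}=\mathbb{E}_{\mathbf{Y},\mathbf{X}}[\log p_{\mathrm p}(\mathbf{y}|\mathbf{x})]-\mathbb{E}_{\mathbf{Y}}[\log p_{\mathrm p}(\mathbf{y})],$$ in which the expectations are taken with respect to the true joint distribution of $(\mathbf{x},\mathbf{y})$, equals $$I_{\mathrm{LB}}^{\mathrm{WLD}}=\log\det\big(\mathbf{I}+\beta\mathbf{L}_{\mathrm p}^\dagger\mathbf{L}_{\mathrm p}\big)-\mathrm{Tr}\big((\mathbf{I}-\mathbf{W}_{\mathrm p}\mathbf{W}_{\mathrm p}^\dagger)(\mathbf{I}+\beta\mathbf{L}_{\mathrm p}\mathbf{L}_{\mathrm p}^\dagger)^{-1}\big).$$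
   Context: The thin QL decomposition $\mathbf{H}=\mathbf{Q}\mathbf{L}$ means that $\mathbf{Q}\in\mathbb{C}^{N_r\times N_t}$ has orthonormal columns and $\mathbf{L}\in\mathbb{C}^{N_t\times N_t}$ is lower triangular with real positive diagonal entries. For a square matrix $\mathbf{A}$, $\operatorname{diag}(\mathbf{A})$ denotes the diagonal matrix having the same diagonal entries as $\mathbf{A}$. The superscript $\dagger$ denotes conjugate transpose, and $\log$ is the natural logarithm. *)

theory Defs
  imports "HOL-Probability.Probability" "Jordan_Normal_Form.Schur_Decomposition"
    "Jordan_Normal_Form.Gauss_Jordan_Elimination" "Jordan_Normal_Form.DL_Rank"
begin

definition minv :: "complex mat \<Rightarrow> complex mat" where
  "minv A = the (mat_inverse A)"

definition mtrace :: "complex mat \<Rightarrow> complex" where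
  "mtrace A = (\<Sum>i<dim_row A. A $$ (i,i))"

definition lower_triangular :: "complex mat \<Rightarrow> bool" where
  "lower_triangular A \<longleftrightarrow>
     (\<forall>i j. i < dim_row A \<longrightarrow> j < dim_col A \<longrightarrow> i < j \<longrightarrow> A $$ (i,j) = 0)"

definition thin_QL :: "complex mat \<Rightarrow> complex mat \<Rightarrow> complex mat \<Rightarrow> bool" where
  "thin_QL H Q L \<longleftrightarrow>
     Q \<in> carrier_mat (dim_row H) (dim_col H) \<and>
     L \<in> carrier_mat (dim_col H) (dim_col H) \<and>
     mat_adjoint Q * Q = 1\<^sub>m (dim_col H) \<and>
     lower_triangular L \<and>
     (\<forall>i < dim_col H. L $$ (i,i) \<in> \<real> \<and> Re (L $$ (i,i)) > 0) \<and>
     H = Q * L"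

definition lr_block :: "nat \<Rightarrow> complex mat \<Rightarrow> complex mat" where
  "lr_block \<nu> L = mat (dim_row L - \<nu>) (dim_col L - \<nu>) (\<lambda>(i,j). L $$ (\<nu> + i, \<nu> + j))"

text \<open>\<Sigma> = diag(S^-1 S^-\<dagger>)^(-1/2): the diagonal entries of S^-1 S^-\<dagger> are positive reals,
  so this is the diagonal matrix with entries 1/sqrt of those entries.\<close>
definition Sigma_mat :: "complex mat \<Rightarrow> complex mat" where
  "Sigma_mat S = (let D = minv S * mat_adjoint (minv S) in
     mat (dim_row S) (dim_row S)
       (\<lambda>(i,j). if i = j then complex_of_real (1 / sqrt (Re (D $$ (i,i)))) else 0))"

definition W_p :: "nat \<Rightarrow> complex mat \<Rightarrow> complex mat" where
  "W_p \<nu> L = (let S = lr_block \<nu> L in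
     four_block_mat (1\<^sub>m \<nu>) (0\<^sub>m \<nu> (dim_row S)) (0\<^sub>m (dim_row S) \<nu>) (Sigma_mat S * minv S))"

definition L_p :: "nat \<Rightarrow> complex mat \<Rightarrow> complex mat" where
  "L_p \<nu> L = W_p \<nu> L * L"

definition F_p :: "real \<Rightarrow> nat \<Rightarrow> complex mat \<Rightarrow> complex mat \<Rightarrow> complex mat" where
  "F_p N0 \<nu> Q L = complex_of_real (1 / N0) \<cdot>\<^sub>m (Q * mat_adjoint (W_p \<nu> L) * L_p \<nu> L)"

definition G_p :: "real \<Rightarrow> nat \<Rightarrow> complex mat \<Rightarrow> complex mat" where
  "G_p N0 \<nu> L = complex_of_real (1 / N0) \<cdot>\<^sub>m (mat_adjoint (L_p \<nu> L) * L_p \<nu> L)"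

definition Cspace :: "nat \<Rightarrow> (nat \<Rightarrow> complex) measure" where
  "Cspace n = PiM {..<n} (\<lambda>_. (lborel :: complex measure))"

definition cn_density :: "nat \<Rightarrow> real \<Rightarrow> (nat \<Rightarrow> complex) \<Rightarrow> real" where
  "cn_density n s x = (1 / (pi * s)) ^ n * exp (- (\<Sum>i<n. (cmod (x i))\<^sup>2) / s)"

definition sesq :: "complex mat \<Rightarrow> (nat \<Rightarrow> complex) \<Rightarrow> (nat \<Rightarrow> complex) \<Rightarrow> complex" where
  "sesq A y x = (\<Sum>i<dim_row A. \<Sum>j<dim_col A. cnj (y i) * A $$ (i,j) * x j)"

definition channel :: "complex mat \<Rightarrow> (nat \<Rightarrow> complex) \<Rightarrow> (nat \<Rightarrow> complex) \<Rightarrow> (nat \<Rightarrow> complex)" where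
  "channel H x z = restrict (\<lambda>i. (\<Sum>j<dim_col H. H $$ (i,j) * x j) + z i) {..<dim_row H}"

definition joint_xy :: "complex mat \<Rightarrow> real \<Rightarrow> real \<Rightarrow> ((nat \<Rightarrow> complex) \<times> (nat \<Rightarrow> complex)) measure" where
  "joint_xy H Es N0 =
     distr (density (Cspace (dim_col H) \<Otimes>\<^sub>M Cspace (dim_row H))
              (\<lambda>(x,z). ennreal (cn_density (dim_col H) Es x * cn_density (dim_row H) N0 z)))
           (Cspace (dim_col H) \<Otimes>\<^sub>M Cspace (dim_row H))
           (\<lambda>(x,z). (x, channel H x z))"

definition prior :: "nat \<Rightarrow> real \<Rightarrow> (nat \<Rightarrow> complex) measure" where
  "prior n Es = density (Cspace n) (\<lambda>x. ennreal (cn_density n Es x))"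

text \<open>Mismatched model p_p(y|x) = exp(2 Re{y^\<dagger> F x} - x^\<dagger> G x); x^\<dagger> G x is real (G Hermitian).\<close>
definition pp_cond :: "complex mat \<Rightarrow> complex mat \<Rightarrow> (nat \<Rightarrow> complex) \<Rightarrow> (nat \<Rightarrow> complex) \<Rightarrow> real" where
  "pp_cond F G y x = exp (2 * Re (sesq F y x) - Re (sesq G x x))"

definition pp_marg :: "complex mat \<Rightarrow> complex mat \<Rightarrow> real \<Rightarrow> (nat \<Rightarrow> complex) \<Rightarrow> real" where
  "pp_marg F G Es y = (\<integral>x. pp_cond F G y x \<partial>prior (dim_col G) Es)"

definition I_LB_WLD :: "complex mat \<Rightarrow> complex mat \<Rightarrow> complex mat \<Rightarrow> nat \<Rightarrow> real \<Rightarrow> real \<Rightarrow> real" where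
  "I_LB_WLD H Q L \<nu> Es N0 =
     (let F = F_p N0 \<nu> Q L; G = G_p N0 \<nu> L; J = joint_xy H Es N0 in
       (\<integral>w. ln (pp_cond F G (snd w) (fst w)) \<partial>J)
       - (\<integral>y. ln (pp_marg F G Es y) \<partial>distr J (Cspace (dim_row H)) snd))"

end

(*
Write G = L_p^H L_p / N0 and C = I + Es G, where ^H is the conjugate transpose.  Two facts about the
statistics drive everything: H^H F = G (because Q^H Q = I and L_p = W_p L), and the mismatched marginal
is a Gaussian integral,
  p_p(y) = exp (Es y^H F C^-1 F^H y) / det C.
To evaluate that integral without a change of variables on C^n, decompose C = T^H diag(d) T with T unit
lower triangular; then the last coordinate occurs in one square only and can be integrated out by
translation invariance, so Fubini and induction give the product of the pi/d_k, while det C is the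
product of the d_k.
Both expectations are second moments of (x, y) and become traces.  With Es G = C - I and the
push-through identity (I + b X X^H)^-1 = I - b X (I + b X^H X)^-1 X^H, they collapse to the claimed
trace plus tr (I - W_p W_p^H), and the latter vanishes since Sigma normalises the rows of S^-1.
*)
theory Submission
  imports Defs
begin

section \<open>Complex Gaussian moments\<close>

text \<open>The result is an equation between complex numbers although the rate is real. So two
  further facts are needed: the determinant is positive, which makes \<open>Ln\<close> the real
  logarithm, and the trace on the right is real, being that of a product of two Hermitian matrices.
  The matrix W W^H of the puncturing filter W enters through the noise alone. The covariance of y is
  Es H H^H + N0 I. Its signal part sees F only through H^H F = G, while its noise part sees F^H F =
  L_p^H W W^H L_p / N0^2. For unitary W the trace term would vanish. One set of pivots d serves both
  the Gaussian integral and the determinant, so the normalising constant of the marginal becomes det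
  C without any spectral theory. Moments are stated with \<open>has_bochner_integral\<close> rather
  than as bare integrals: a Bochner integral defaults to 0 when integrability fails, and linearity
  needs integrability of each term.\<close>

lemma borel_measurable_cnj: "f \<in> borel_measurable M \<Longrightarrow> (\<lambda>x. cnj (f x)) \<in> borel_measurable M"
  by (erule measurable_compose) (intro borel_measurable_continuous_onI continuous_intros)

text \<open>Lebesgue measure on the plane is the image of the product of real Lebesgue measures
  indexed by the basis vectors 1 and i, so this is Fubini for a product function. The auxiliary
  \<open>h\<close> assigns \<open>f\<close> to 1 and \<open>g\<close> to i.\<close>

lemma has_bochner_integral_lborel_complex:
  fixes f g :: "real \<Rightarrow> complex"
  assumes f: "has_bochner_integral lborel f a" and g: "has_bochner_integral lborel g b"
  shows "has_bochner_integral (lborel :: complex measure) (\<lambda>x. f (Re x) * g (Im x)) (a * b)"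
proof -
  interpret product_sigma_finite "\<lambda>_ :: complex. lborel :: real measure" ..
  define h where "h b = (if b = 1 then f else g)" for b :: complex
  have [measurable]: "f \<in> borel_measurable borel" "g \<in> borel_measurable borel"
    using f g by (auto dest!: borel_measurable_has_bochner_integral)
  have int: "integrable lborel (h b)" for b
    using f g by (auto simp: h_def has_bochner_integral_iff)
  let ?\<phi> = "\<lambda>f. \<Sum>b\<in>Basis. f b *\<^sub>R b :: complex"
  have eq: "f (Re (?\<phi> y)) * g (Im (?\<phi> y)) = (\<Prod>b\<in>Basis. h b (y b))" for y
    by (simp add: Basis_complex_def h_def)
  have "has_bochner_integral (\<Pi>\<^sub>M b\<in>Basis. lborel) (\<lambda>y. f (Re (?\<phi> y)) * g (Im (?\<phi> y))) (a * b)"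
    unfolding eq has_bochner_integral_iff
  proof
    show "integrable (\<Pi>\<^sub>M b\<in>Basis. lborel) (\<lambda>y. \<Prod>b\<in>Basis. h b (y b))"
      by (intro product_integrable_prod int) simp
    show "(\<integral>y. (\<Prod>b\<in>Basis. h b (y b)) \<partial>(\<Pi>\<^sub>M b\<in>Basis. lborel)) = a * b"
      using f g by (subst product_integral_prod)
        (auto simp: int Basis_complex_def h_def has_bochner_integral_iff)
  qed
  then show ?thesis
    by (subst lborel_eq) (intro has_bochner_integral_distr, auto)
qed

text \<open>The circularly symmetric Gaussian density CN(0, s) in one complex variable, the
  coordinate factor of \<open>cn_density\<close>.\<close>

definition cnormal :: "real \<Rightarrow> complex \<Rightarrow> real" where
  "cnormal s x = 1 / (pi * s) * exp (- (cmod x)\<^sup>2 / s)"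

text \<open>Real and imaginary part share the variance s equally, hence the standard deviation
  \<open>sqrt (s / 2)\<close>.\<close>

lemma cnormal_eq_normal_density:
  assumes "s > 0"
  shows "cnormal s x = normal_density 0 (sqrt (s / 2)) (Re x) * normal_density 0 (sqrt (s / 2)) (Im x)"
proof -
  have "exp (- (cmod x)\<^sup>2 / s) = exp (- (Re x)\<^sup>2 / s) * exp (- (Im x)\<^sup>2 / s)"
    unfolding exp_add[symmetric] by (simp add: cmod_power2 diff_divide_distrib)
  then show ?thesis
    using assms by (simp add: cnormal_def normal_density_def)
qed

lemma borel_measurable_cnormal[measurable]: "cnormal s \<in> borel_measurable borel"
  unfolding cnormal_def by measurable

text \<open>Each integrand splits into products of a function of the real part and one of the
  imaginary part, so real normal moments suffice. The variance is s/2 + s/2.\<close>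

lemma cnormal_moments:
  assumes s: "s > 0"
  shows has_bochner_integral_cnormal:
      "has_bochner_integral lborel (\<lambda>x. complex_of_real (cnormal s x)) 1" (is ?M0)
    and has_bochner_integral_cnormal_mean:
      "has_bochner_integral lborel (\<lambda>x. complex_of_real (cnormal s x) * x) 0" (is ?M1)
    and has_bochner_integral_cnormal_cnj_mean:
      "has_bochner_integral lborel (\<lambda>x. complex_of_real (cnormal s x) * cnj x) 0" (is ?M1')
    and has_bochner_integral_cnormal_variance:
      "has_bochner_integral lborel (\<lambda>x. complex_of_real (cnormal s x) * (cnj x * x)) (complex_of_real s)" (is ?M2)
proof -
  define d where "d = normal_density 0 (sqrt (s / 2))"
  have "has_bochner_integral lborel d 1"
    using s by (auto simp: d_def has_bochner_integral_iff)
  then have m0: "has_bochner_integral lborel (\<lambda>x. complex_of_real (d x)) 1"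
    using has_bochner_integral_of_real by fastforce
  have "has_bochner_integral lborel (\<lambda>x. d x * x) 0"
    using normal_moment_nz_1[of "sqrt (s / 2)" 0] s by (auto simp: d_def)
  then have m1: "has_bochner_integral lborel (\<lambda>x. complex_of_real (d x * x)) 0"
    using has_bochner_integral_of_real by fastforce
  have "has_bochner_integral lborel (\<lambda>x. d x * x ^ 2) (s / 2)"
    using normal_moment_even[of "sqrt (s / 2)" 0 1] s by (auto simp: d_def)
  then have m2: "has_bochner_integral lborel (\<lambda>x. complex_of_real (d x * x ^ 2)) (complex_of_real (s / 2))"
    by (rule has_bochner_integral_of_real)
  have d: "complex_of_real (cnormal s x) = complex_of_real (d (Re x)) * complex_of_real (d (Im x))" for x
    using s by (simp add: cnormal_eq_normal_density d_def)
  show ?M0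
    using has_bochner_integral_lborel_complex[OF m0 m0] by (simp add: d)
  show M1: ?M1
  proof -
    have "complex_of_real (cnormal s x) * x =
      complex_of_real (d (Re x) * Re x) * complex_of_real (d (Im x)) +
      complex_of_real (d (Re x)) * complex_of_real (d (Im x) * Im x) * \<i>" for x
      by (simp add: d complex_eq_iff)
    then show ?thesis
      using has_bochner_integral_add[OF has_bochner_integral_lborel_complex[OF m1 m0]
          has_bochner_integral_mult_left[OF has_bochner_integral_lborel_complex[OF m0 m1]], of \<i>]
      by simp
  qed
  show ?M1'
    using has_bochner_integral_cnj[OF M1] by simp
  show ?M2
  proof -
    have "complex_of_real (cnormal s x) * (cnj x * x) =
      complex_of_real (d (Re x) * Re x ^ 2) * complex_of_real (d (Im x)) +
      complex_of_real (d (Re x)) * complex_of_real (d (Im x) * Im x ^ 2)" for x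
      by (simp add: d complex_eq_iff power2_eq_square algebra_simps)
    then show ?thesis
      using has_bochner_integral_add[OF has_bochner_integral_lborel_complex[OF m2 m0]
          has_bochner_integral_lborel_complex[OF m0 m2]]
      by simp
  qed
qed

section \<open>The isotropic Gaussian law on C^n: product structure, mean and covariance\<close>

lemma cn_density_eq_prod: "cn_density n s x = (\<Prod>i<n. cnormal s (x i))"
proof -
  have "exp (- (\<Sum>i<n. (cmod (x i))\<^sup>2) / s) = (\<Prod>i<n. exp (- (cmod (x i))\<^sup>2 / s))"
    by (simp add: exp_sum[symmetric] sum_negf sum_divide_distrib)
  then show ?thesis
    unfolding cn_density_def cnormal_def by (simp add: prod.distrib power_divide prod_dividef)
qed

lemma cn_density_nonneg: "s > 0 \<Longrightarrow> 0 \<le> cn_density n s x"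
  by (simp add: cn_density_def)

lemma sigma_finite_Cspace: "sigma_finite_measure (Cspace n)"
proof -
  interpret finite_product_sigma_finite "\<lambda>_ :: nat. lborel :: complex measure" "{..<n}"
    by standard auto
  show ?thesis unfolding Cspace_def by (rule sigma_finite_measure_axioms)
qed

lemma measurable_Cspace_component: "i < n \<Longrightarrow> (\<lambda>x. x i) \<in> borel_measurable (Cspace n)"
  unfolding Cspace_def using measurable_component_singleton[of i "{..<n}" "\<lambda>_. lborel"] by simp

lemma borel_measurable_Cspace_prod:
  fixes f :: "nat \<Rightarrow> complex \<Rightarrow> 'b :: {real_normed_field, second_countable_topology}"
  assumes "\<And>i. i < n \<Longrightarrow> f i \<in> borel_measurable borel"
  shows "(\<lambda>x. \<Prod>i<n. f i (x i)) \<in> borel_measurable (Cspace n)"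
  using assms by (intro borel_measurable_prod measurable_compose[OF measurable_Cspace_component]) auto

lemma borel_measurable_cn_density[measurable]: "cn_density n s \<in> borel_measurable (Cspace n)"
  unfolding cn_density_eq_prod[abs_def] by (rule borel_measurable_Cspace_prod) simp

lemma has_bochner_integral_Cspace_prod:
  fixes f :: "nat \<Rightarrow> complex \<Rightarrow> complex"
  assumes "\<And>i. i < n \<Longrightarrow> has_bochner_integral lborel (f i) (a i)"
  shows "has_bochner_integral (Cspace n) (\<lambda>x. \<Prod>i<n. f i (x i)) (\<Prod>i<n. a i)"
proof -
  interpret product_sigma_finite "\<lambda>_ :: nat. lborel :: complex measure" ..
  show ?thesis
    using assms unfolding has_bochner_integral_iff Cspace_def
    by (subst product_integral_prod) (auto intro!: product_integrable_prod)
qed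

lemma has_bochner_integral_priorI:
  fixes f :: "(nat \<Rightarrow> complex) \<Rightarrow> complex"
  assumes "s > 0" "f \<in> borel_measurable (Cspace n)"
    and "has_bochner_integral (Cspace n) (\<lambda>x. complex_of_real (cn_density n s x) * f x) a"
  shows "has_bochner_integral (prior n s) f a"
  unfolding prior_def using assms
  by (intro has_bochner_integral_density) (auto simp: cn_density_nonneg scaleR_conv_of_real)

text \<open>Independence of the coordinates: the density is a product, so each one-coordinate factor
  takes its own \<open>cnormal\<close> and the integral factorises.\<close>

lemma has_bochner_integral_prior_cnormal_prod:
  assumes s: "s > 0"
    and [measurable]: "\<And>i. i < n \<Longrightarrow> f i \<in> borel_measurable borel"
    and hb: "\<And>i. i < n \<Longrightarrow> has_bochner_integral lborel (\<lambda>x. complex_of_real (cnormal s x) * f i x) (a i)"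
  shows "has_bochner_integral (prior n s) (\<lambda>x. \<Prod>i<n. f i (x i)) (\<Prod>i<n. a i)"
proof (rule has_bochner_integral_priorI[OF s])
  show "(\<lambda>x. \<Prod>i<n. f i (x i)) \<in> borel_measurable (Cspace n)"
    by (rule borel_measurable_Cspace_prod) simp
  show "has_bochner_integral (Cspace n)
      (\<lambda>x. complex_of_real (cn_density n s x) * (\<Prod>i<n. f i (x i))) (\<Prod>i<n. a i)"
    using has_bochner_integral_Cspace_prod[OF hb]
    by (simp add: cn_density_eq_prod prod.distrib)
qed

lemma has_bochner_integral_prior_one:
  assumes "s > 0"
  shows "has_bochner_integral (prior n s) (\<lambda>_. 1 :: complex) 1"
  using has_bochner_integral_prior_cnormal_prod[OF assms, of n "\<lambda>_ _. 1" "\<lambda>_. 1"]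
    has_bochner_integral_cnormal[OF assms] by simp

lemma has_bochner_integral_prior_mean:
  assumes s: "s > 0" and i: "i < n"
  shows "has_bochner_integral (prior n s) (\<lambda>x. x i) 0"
proof -
  \<comment> \<open>A single coordinate is a product over all coordinates with factor 1 away from
    \<open>i\<close>; the factor at \<open>i\<close> has mean 0 and annihilates the product.\<close>
  have "has_bochner_integral (prior n s) (\<lambda>x. \<Prod>k<n. if k = i then x k else 1)
      (\<Prod>k<n. if k = i then 0 else 1)"
    by (rule has_bochner_integral_prior_cnormal_prod[OF s])
      (auto simp: has_bochner_integral_cnormal has_bochner_integral_cnormal_mean s)
  with i show ?thesis
    by (simp add: prod.delta)
qed

lemma has_bochner_integral_prior_covariance:
  assumes s: "s > 0" and i: "i < n" "j < n"
  shows "has_bochner_integral (prior n s) (\<lambda>x. cnj (x i) * x j) (if i = j then complex_of_real s else 0)"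
proof -
  \<comment> \<open>Two separate indicator factors cover both cases at once: for
    \<open>i = j\<close> they meet in one coordinate and give the variance, otherwise two
    coordinates each contribute a vanishing mean.\<close>
  have "has_bochner_integral (prior n s)
     (\<lambda>x. \<Prod>k<n. (if k = i then cnj (x k) else 1) * (if k = j then x k else 1))
     (\<Prod>k<n. if k = i then if k = j then complex_of_real s else 0 else if k = j then 0 else 1)"
  proof (rule has_bochner_integral_prior_cnormal_prod[OF s], goal_cases)
    case (1 k)
    then show ?case
      by (cases "k = i"; cases "k = j") (auto intro!: borel_measurable_continuous_onI continuous_intros)
  next
    case (2 k)
    then show ?case
      using has_bochner_integral_cnormal[OF s] has_bochner_integral_cnormal_mean[OF s]
        has_bochner_integral_cnormal_cnj_mean[OF s] has_bochner_integral_cnormal_variance[OF s]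
      by auto
  qed
  also have "(\<Prod>k<n. if k = i then if k = j then complex_of_real s else 0 else if k = j then 0 else 1)
      = (if i = j then complex_of_real s else 0)"
  proof (cases "i = j")
    case True
    then have "(\<Prod>k<n. if k = i then if k = j then complex_of_real s else 0 else if k = j then 0 else 1)
      = (\<Prod>k<n. if k = i then complex_of_real s else 1)" by (intro prod.cong) auto
    then show ?thesis using i True by (simp add: prod.delta)
  next
    case False
    then show ?thesis using i by (auto intro!: prod_zero bexI[of _ i])
  qed
  finally show ?thesis
    using i by (simp add: prod.distrib prod.delta)
qed

text \<open>Used for the independence of signal and noise, whose joint law is a product
  measure.\<close>

lemma (in pair_sigma_finite) has_bochner_integral_pair_mult:
  fixes f :: "'a \<Rightarrow> complex" and g :: "'b \<Rightarrow> complex"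
  assumes f: "has_bochner_integral M1 f a" and g: "has_bochner_integral M2 g b"
  shows "has_bochner_integral (M1 \<Otimes>\<^sub>M M2) (\<lambda>p. f (fst p) * g (snd p)) (a * b)"
proof -
  have [measurable]: "f \<in> borel_measurable M1" "g \<in> borel_measurable M2"
    using f g by (auto dest!: borel_measurable_has_bochner_integral)
  have int: "integrable (M1 \<Otimes>\<^sub>M M2) (\<lambda>p. f (fst p) * g (snd p))"
    using f g by (intro Fubini_integrable)
      (auto simp: has_bochner_integral_iff norm_mult intro!: integrable_mult_left)
  then show ?thesis
    using f g integral_fst'[OF int] by (simp add: has_bochner_integral_iff)
qed

section \<open>Gaussian integrals of Hermitian forms\<close>

text \<open>Induction via the Schur complement of the last diagonal entry.\<close>
lemma ldl_decomposition:
  fixes A :: "nat \<Rightarrow> nat \<Rightarrow> complex"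
  assumes "\<And>i j. i < n \<Longrightarrow> j < n \<Longrightarrow> A i j = cnj (A j i)"
    and "\<And>x. \<exists>i<n. x i \<noteq> 0 \<Longrightarrow> Re (\<Sum>i<n. \<Sum>j<n. cnj (x i) * A i j * x j) > 0"
  shows "\<exists>T d. (\<forall>k<n. d k > (0::real)) \<and> (\<forall>k<n. T k k = 1) \<and> (\<forall>k<n. \<forall>j. k < j \<longrightarrow> T k j = 0) \<and>
    (\<forall>i<n. \<forall>j<n. A i j = (\<Sum>k<n. cnj (T k i) * complex_of_real (d k) * T k j))"
  using assms
proof (induction n arbitrary: A)
  case 0
  then show ?case by simp
next
  case (Suc n)
  define a where "a = Re (A n n)"
  have Ann: "A n n = complex_of_real a"
    using Suc.prems(1)[of n n] by (simp add: a_def complex_eq_iff)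
  have a: "a > 0"
  proof -
    \<comment> \<open>Positivity is tested on the last unit vector, which isolates the corner entry
      and makes the pivot \<open>a\<close> positive.\<close>
    have "(\<Sum>i<Suc n. \<Sum>j<Suc n. cnj (if i = n then 1 else 0) * A i j * (if j = n then 1 else 0)) = A n n"
      by (simp add: if_distrib[of cnj] if_distrib[of "\<lambda>x. x * _"] cong: if_cong)
    with Suc.prems(2)[of "\<lambda>i. if i = n then 1 else 0"] show ?thesis
      by (auto simp: a_def)
  qed
  define B where "B i j = A i j - A i n * A n j / complex_of_real a" for i j
  have Bherm: "B i j = cnj (B j i)" if "i < n" "j < n" for i j
  proof -
    have "A i j = cnj (A j i)" "A i n = cnj (A n i)" "A n j = cnj (A j n)"
      using that by (intro Suc.prems; simp)+
    then show ?thesis by (simp add: B_def)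
  qed
  have Bpd: "Re (\<Sum>i<n. \<Sum>j<n. cnj (x i) * B i j * x j) > 0" if x: "\<exists>i<n. x i \<noteq> 0" for x
  proof -
    define r where "r = (\<Sum>j<n. A n j * x j)"
    \<comment> \<open>With this last coordinate the form of \<open>A\<close> on the extended vector
      equals the form of \<open>B\<close> on \<open>x\<close>: it is the minimiser in the last
      variable. Positivity thus passes from \<open>A\<close> to the complement.\<close>
    define t where "t = - r / complex_of_real a"
    have cr: "(\<Sum>i<n. cnj (x i) * A i n) = cnj r"
    proof -
      have "A i n = cnj (A n i)" if "i < n" for i
        using that by (intro Suc.prems; simp)
      then show ?thesis by (simp add: r_def mult.commute)
    qed
    have "(\<Sum>i<n. \<Sum>j<n. cnj (x i) * B i j * x j)
      = (\<Sum>i<n. \<Sum>j<n. cnj (x i) * A i j * x j)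
        - (\<Sum>i<n. \<Sum>j<n. (cnj (x i) * A i n) * (A n j * x j)) / complex_of_real a"
      by (simp add: B_def algebra_simps sum_subtractf sum_divide_distrib)
    also have "(\<Sum>i<n. \<Sum>j<n. (cnj (x i) * A i n) * (A n j * x j)) = cnj r * r"
      unfolding sum_product[symmetric] cr by (simp add: r_def)
    also have "(\<Sum>i<n. \<Sum>j<n. cnj (x i) * A i j * x j) - cnj r * r / complex_of_real a
      = (\<Sum>i<n. \<Sum>j<n. cnj (x i) * A i j * x j) + cnj r * t + cnj t * r + cnj t * A n n * t"
      using a by (simp add: t_def Ann field_simps)
    also have "\<dots> = (\<Sum>i<Suc n. \<Sum>j<Suc n. cnj ((x(n := t)) i) * A i j * (x(n := t)) j)"
      by (simp add: sum.distrib flip: cr)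
        (simp add: r_def sum_distrib_left sum_distrib_right algebra_simps)
    finally show ?thesis
      using Suc.prems(2)[of "x(n := t)"] x by (metis fun_upd_other less_Suc_eq nat_neq_iff)
  qed
  from Suc.IH[OF Bherm Bpd] obtain T d where
    d: "\<forall>k<n. d k > (0::real)" and T1: "\<forall>k<n. T k k = 1" and T0: "\<forall>k<n. \<forall>j. k < j \<longrightarrow> T k j = 0"
    and B: "\<forall>i<n. \<forall>j<n. B i j = (\<Sum>k<n. cnj (T k i) * complex_of_real (d k) * T k j)"
    by blast
  \<comment> \<open>The new row is the last row of \<open>A\<close> divided by the pivot, so its
    rank-one contribution \<open>A i n * A n j / a\<close> is what \<open>B\<close> subtracts, and
    on the last row and column it returns \<open>A\<close>. The older rows contribute nothing there,
    since their entries vanish for every \<open>j > k\<close>, with no upper bound on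
    \<open>j\<close>.\<close>
  define T' where "T' k j = (if k = n then if j < n then A n j / complex_of_real a else if j = n then 1 else 0
    else T k j)" for k j
  define d' where "d' k = (if k = n then a else d k)" for k
  have "A i j = (\<Sum>k<Suc n. cnj (T' k i) * complex_of_real (d' k) * T' k j)" if "i < Suc n" "j < Suc n" for i j
  proof -
    have s: "(\<Sum>k<n. cnj (T' k i) * complex_of_real (d' k) * T' k j) =
      (\<Sum>k<n. cnj (T k i) * complex_of_real (d k) * T k j)"
      by (intro sum.cong) (auto simp: T'_def d'_def)
    have h: "A i n = cnj (A n i)" if "i < n" for i
      using that by (intro Suc.prems; simp)
    consider "i < n" "j < n" | "i < n" "j = n" | "i = n" "j < n" | "i = n" "j = n"
      using \<open>i < Suc n\<close> \<open>j < Suc n\<close> by linarith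
    then show ?thesis
    proof cases
      case 1
      have "A i j = B i j + A i n * A n j / complex_of_real a"
        by (simp add: B_def)
      with 1 a show ?thesis
        unfolding sum.lessThan_Suc s by (simp add: B T'_def d'_def h)
    next
      case 2
      then show ?thesis unfolding sum.lessThan_Suc s using T0 a by (simp add: T'_def d'_def h)
    next
      case 3
      then show ?thesis unfolding sum.lessThan_Suc s using T0 a by (simp add: T'_def d'_def)
    next
      case 4
      then show ?thesis unfolding sum.lessThan_Suc s using T0 by (simp add: T'_def d'_def Ann)
    qed
  qed
  moreover have "\<forall>k<Suc n. d' k > 0" "\<forall>k<Suc n. T' k k = 1" "\<forall>k<Suc n. \<forall>j. k < j \<longrightarrow> T' k j = 0"
    using d T1 T0 a by (auto simp: d'_def T'_def)
  ultimately show ?case by blast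
qed

text \<open>\<open>cnormal (1 / d)\<close> has total mass 1 and equals the integrand with
  \<open>c = 0\<close> up to the factor \<open>pi / d\<close>; translation invariance brings in
  \<open>c\<close>. The centre has to be arbitrary because it will depend on the other
  coordinates.\<close>

lemma nn_integral_gaussian_complex:
  assumes d: "d > 0"
  shows "(\<integral>\<^sup>+y. ennreal (exp (- (d * (cmod (y - c))\<^sup>2))) \<partial>lborel) = ennreal (pi / d)"
proof -
  have "has_bochner_integral lborel (\<lambda>x. complex_of_real (cnormal (1 / d) x)) 1"
    using d by (intro has_bochner_integral_cnormal) auto
  then have "has_bochner_integral lborel (\<lambda>x. cnormal (1 / d) x) 1"
    using has_bochner_integral_Re by fastforce
  then have "has_bochner_integral lborel (\<lambda>x. cnormal (1 / d) x * (pi / d)) (1 * (pi / d))"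
    by (intro has_bochner_integral_mult_left)
  moreover have "cnormal (1 / d) x * (pi / d) = exp (- (d * (cmod x)\<^sup>2))" for x
    using d by (simp add: cnormal_def)
  ultimately have *: "has_bochner_integral lborel (\<lambda>x. exp (- (d * (cmod x)\<^sup>2))) (pi / d)"
    by simp
  have "(\<integral>\<^sup>+y. ennreal (exp (- (d * (cmod (y - c))\<^sup>2))) \<partial>lborel) =
    (\<integral>\<^sup>+y. ennreal (exp (- (d * (cmod (y - c))\<^sup>2))) \<partial>distr lborel borel ((+) c))"
    by (simp add: lborel_distr_plus)
  also have "\<dots> = (\<integral>\<^sup>+y. ennreal (exp (- (d * (cmod y)\<^sup>2))) \<partial>lborel)"
    by (subst nn_integral_distr) auto
  also have "\<dots> = ennreal (pi / d)"
    using * by (subst nn_integral_eq_integral) (auto simp: has_bochner_integral_iff)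
  finally show ?thesis .
qed

lemma borel_measurable_triangular_form:
  "(\<lambda>x. ennreal (exp (- (\<Sum>k<n. d k * (cmod (x k + (\<Sum>j<k. T k j * x j) - c k))\<^sup>2))))
    \<in> borel_measurable (Cspace n)"
proof -
  have "(\<lambda>x. x k + (\<Sum>j<k. T k j * x j) - c k) \<in> borel_measurable (Cspace n)" if "k < n" for k
    using that by (intro borel_measurable_diff borel_measurable_add borel_measurable_sum
      borel_measurable_times measurable_Cspace_component borel_measurable_const) auto
  then have [measurable]: "(\<lambda>x. \<Sum>k<n. d k * (cmod (x k + (\<Sum>j<k. T k j * x j) - c k))\<^sup>2) \<in> borel_measurable (Cspace n)"
    by (intro borel_measurable_sum borel_measurable_times borel_measurable_power
      borel_measurable_norm borel_measurable_const) auto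
  show ?thesis by measurable
qed

text \<open>The map sending \<open>x k\<close> to \<open>x k\<close> plus a combination of earlier
  coordinates is a shear of determinant 1, which is why neither \<open>T\<close> nor
  \<open>c\<close> appears in the value. The unit diagonal is written out as the separate summand
  \<open>x k\<close>.\<close>

lemma nn_integral_gaussian_triangular:
  assumes "\<And>k. k < n \<Longrightarrow> d k > 0"
  shows "(\<integral>\<^sup>+x. ennreal (exp (- (\<Sum>k<n. d k * (cmod (x k + (\<Sum>j<k. T k j * x j) - c k))\<^sup>2))) \<partial>Cspace n)
    = ennreal (\<Prod>k<n. pi / d k)"
  using assms
proof (induction n)
  case 0
  \<comment> \<open>The empty product measure is a unit point mass, and the empty exponent gives
    1.\<close>
  show ?case by (simp add: Cspace_def nn_integral_count_space PiM_empty)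
next
  case (Suc n)
  interpret product_sigma_finite "\<lambda>_ :: nat. lborel :: complex measure" ..
  define f where "f m x = ennreal (exp (- (\<Sum>k<m. d k * (cmod (x k + (\<Sum>j<k. T k j * x j) - c k))\<^sup>2)))"
    for m and x :: "nat \<Rightarrow> complex"
  have meas: "f m \<in> borel_measurable (Cspace m)" for m
    unfolding f_def by (rule borel_measurable_triangular_form)
  \<comment> \<open>Changing coordinate \<open>n\<close> affects only the last square, as the
    earlier ones involve indices below \<open>n\<close>. In that square the linear terms form the
    centre of a one-variable Gaussian in \<open>y\<close>.\<close>
  have upd: "f (Suc n) (x(n := y)) = f n x *
    ennreal (exp (- (d n * (cmod (y - (c n - (\<Sum>j<n. T n j * x j))))\<^sup>2)))" for x y
  proof -
    have "(\<Sum>k<n. d k * (cmod ((x(n := y)) k + (\<Sum>j<k. T k j * (x(n := y)) j) - c k))\<^sup>2) =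
      (\<Sum>k<n. d k * (cmod (x k + (\<Sum>j<k. T k j * x j) - c k))\<^sup>2)"
    proof (intro sum.cong refl)
      fix k assume "k \<in> {..<n}"
      moreover from this have "(\<Sum>j<k. T k j * (x(n := y)) j) = (\<Sum>j<k. T k j * x j)"
        by (intro sum.cong) auto
      ultimately show "d k * (cmod ((x(n := y)) k + (\<Sum>j<k. T k j * (x(n := y)) j) - c k))\<^sup>2 =
          d k * (cmod (x k + (\<Sum>j<k. T k j * x j) - c k))\<^sup>2"
        by (simp only: fun_upd_apply) auto
    qed
    moreover have "(\<Sum>j<n. T n j * (x(n := y)) j) = (\<Sum>j<n. T n j * x j)"
      by (intro sum.cong) auto
    ultimately show ?thesis
      unfolding f_def sum.lessThan_Suc
      by (simp add: ennreal_mult[symmetric] exp_add[symmetric] algebra_simps del: fun_upd_apply)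
        (simp add: algebra_simps)
  qed
  have "(\<integral>\<^sup>+x. f (Suc n) x \<partial>Cspace (Suc n)) =
    (\<integral>\<^sup>+x. (\<integral>\<^sup>+y. f (Suc n) (x(n := y)) \<partial>lborel) \<partial>Cspace n)"
    using product_nn_integral_insert[of "{..<n}" n "f (Suc n)"] meas[of "Suc n"]
    by (simp add: Cspace_def lessThan_Suc)
  also have "\<dots> = (\<integral>\<^sup>+x. f n x * ennreal (pi / d n) \<partial>Cspace n)"
    unfolding upd using Suc.prems
    by (simp add: nn_integral_cmult nn_integral_gaussian_complex)
  also have "\<dots> = ennreal (\<Prod>k<n. pi / d k) * ennreal (pi / d n)"
  proof -
    have "(\<integral>\<^sup>+x. f n x \<partial>Cspace n) = ennreal (\<Prod>k<n. pi / d k)"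
      using Suc.IH Suc.prems by (simp add: f_def)
    then show ?thesis using meas by (simp add: nn_integral_multc)
  qed
  also have "\<dots> = ennreal (\<Prod>k<Suc n. pi / d k)"
    using Suc.prems by (subst ennreal_mult[symmetric]) (auto intro!: prod_nonneg simp: less_imp_le)
  finally show ?case unfolding f_def .
qed

text \<open>Here \<open>A = T\<^sup>\<dagger> diag(d) T\<close>, and completing the square around the solution \<open>u\<close> of \<open>A u = b\<close>
  leaves a triangular form.\<close>
lemma nn_integral_gaussian_quadratic:
  fixes A :: "nat \<Rightarrow> nat \<Rightarrow> complex" and d :: "nat \<Rightarrow> real"
  assumes d: "\<And>k. k < n \<Longrightarrow> d k > 0" and T1: "\<And>k. k < n \<Longrightarrow> T k k = 1"
    and T0: "\<And>k j. k < n \<Longrightarrow> k < j \<Longrightarrow> T k j = 0"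
    and A: "\<And>i j. i < n \<Longrightarrow> j < n \<Longrightarrow> A i j = (\<Sum>k<n. cnj (T k i) * complex_of_real (d k) * T k j)"
    and u: "\<And>i. i < n \<Longrightarrow> (\<Sum>j<n. A i j * u j) = b i"
  shows "(\<integral>\<^sup>+x. ennreal (exp (2 * Re (\<Sum>i<n. cnj (b i) * x i)
      - Re (\<Sum>i<n. \<Sum>j<n. cnj (x i) * A i j * x j))) \<partial>Cspace n)
    = ennreal (exp (Re (\<Sum>i<n. cnj (b i) * u i)) * (\<Prod>k<n. pi / d k))"
proof -
  \<comment> \<open>\<open>S k x\<close> is coordinate k of T x, and \<open>I\<close> below is the
    sesquilinear form of \<open>A\<close> expressed in these coordinates, where it is
    diagonal.\<close>
  define S where "S k x = (\<Sum>j<n. T k j * x j)" for k and x :: "nat \<Rightarrow> complex"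
  define I where "I x y = (\<Sum>k<n. complex_of_real (d k) * cnj (S k x) * S k y)" for x y
  have form: "(\<Sum>i<n. \<Sum>j<n. cnj (x i) * A i j * y j) = I x y" for x y
  proof -
    have "(\<Sum>i<n. \<Sum>j<n. cnj (x i) * A i j * y j) =
      (\<Sum>i<n. \<Sum>j<n. \<Sum>k<n. complex_of_real (d k) * (cnj (T k i * x i) * (T k j * y j)))"
      by (intro sum.cong refl) (simp add: A sum_distrib_left sum_distrib_right mult_ac)
    also have "\<dots> = (\<Sum>i<n. \<Sum>k<n. \<Sum>j<n. complex_of_real (d k) * (cnj (T k i * x i) * (T k j * y j)))"
      by (intro sum.cong refl sum.swap)
    also have "\<dots> = (\<Sum>k<n. \<Sum>i<n. \<Sum>j<n. complex_of_real (d k) * (cnj (T k i * x i) * (T k j * y j)))"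
      by (rule sum.swap)
    also have "\<dots> = I x y"
      unfolding I_def S_def
      by (simp add: sum_product sum_distrib_left[symmetric] mult.assoc)
    finally show ?thesis .
  qed
  have cnjI: "cnj (I x y) = I y x" for x y
    by (simp add: I_def mult_ac)
  \<comment> \<open>Since b = A u and the form is Hermitian, the linear term is the form evaluated
    at \<open>u\<close> and \<open>x\<close>.\<close>
  have bx: "(\<Sum>i<n. cnj (b i) * x i) = I u x" for x
  proof -
    have "(\<Sum>i<n. cnj (b i) * x i) = cnj (\<Sum>i<n. \<Sum>j<n. cnj (x i) * A i j * u j)"
      by (simp add: u[symmetric] sum_distrib_left sum_distrib_right mult_ac)
    then show ?thesis by (simp add: form cnjI)
  qed
  have Sk: "S k x - S k u = x k + (\<Sum>j<k. T k j * x j) - S k u" if "k < n" for k x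
  proof -
    have "S k x = (\<Sum>j\<in>insert k {..<k}. T k j * x j)"
      unfolding S_def using that T0 by (intro sum.mono_neutral_right) auto
    then show ?thesis using T1 that by simp
  qed
  \<comment> \<open>Completing the square: expand the squares of T (x - u) with weights
    \<open>d\<close> and use that \<open>I x u\<close> and \<open>I u x\<close> have equal real
    parts.\<close>
  have sq: "2 * Re (I u x) - Re (I x x) =
      Re (I u u) - (\<Sum>k<n. d k * (cmod (S k x - S k u))\<^sup>2)" for x
  proof -
    have "complex_of_real (d k * (cmod (S k x - S k u))\<^sup>2) =
      complex_of_real (d k) * cnj (S k x) * S k x + complex_of_real (d k) * cnj (S k u) * S k u
      - complex_of_real (d k) * cnj (S k u) * S k x - complex_of_real (d k) * cnj (S k x) * S k u" for k
      unfolding of_real_mult complex_norm_square by (simp add: algebra_simps)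
    then have "complex_of_real (\<Sum>k<n. d k * (cmod (S k x - S k u))\<^sup>2) = I x x + I u u - I u x - I x u"
      unfolding I_def of_real_sum by (simp add: sum.distrib sum_subtractf)
    then have "(\<Sum>k<n. d k * (cmod (S k x - S k u))\<^sup>2) = Re (I x x) + Re (I u u) - Re (I u x) - Re (I x u)"
      by (metis Re_complex_of_real minus_complex.simps(1) plus_complex.simps(1))
    moreover have "Re (I x u) = Re (I u x)"
      by (metis cnjI complex_cnj(1) complex.sel(1) cnj.simps(1))
    ultimately show ?thesis by simp
  qed
  \<comment> \<open>Only T u is needed as the centre of the triangular form, so x is never shifted
    by u in the integral.\<close>
  have tri: "(\<Sum>k<n. d k * (cmod (S k x - S k u))\<^sup>2) =
    (\<Sum>k<n. d k * (cmod (x k + (\<Sum>j<k. T k j * x j) - S k u))\<^sup>2)" for x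
    using Sk by (intro sum.cong) auto
  have "(\<integral>\<^sup>+x. ennreal (exp (2 * Re (\<Sum>i<n. cnj (b i) * x i)
      - Re (\<Sum>i<n. \<Sum>j<n. cnj (x i) * A i j * x j))) \<partial>Cspace n) =
    (\<integral>\<^sup>+x. ennreal (exp (Re (I u u))) *
      ennreal (exp (- (\<Sum>k<n. d k * (cmod (x k + (\<Sum>j<k. T k j * x j) - S k u))\<^sup>2))) \<partial>Cspace n)"
    unfolding form bx sq tri by (simp add: ennreal_mult[symmetric] exp_add[symmetric])
  also have "\<dots> = ennreal (exp (Re (I u u))) * ennreal (\<Prod>k<n. pi / d k)"
    by (simp add: nn_integral_cmult borel_measurable_triangular_form nn_integral_gaussian_triangular d)
  also have "\<dots> = ennreal (exp (Re (I u u)) * (\<Prod>k<n. pi / d k))"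
    using d by (subst ennreal_mult) (auto intro!: prod_nonneg simp: less_imp_le)
  finally show ?thesis by (simp add: bx)
qed

section \<open>Adjoints, traces and inverses\<close>

lemma dim_mat_adjoint[simp]:
  "dim_row (mat_adjoint A) = dim_col A" "dim_col (mat_adjoint A) = dim_row A"
  by (simp_all add: mat_adjoint_def)

lemma mat_adjoint_carrier: "A \<in> carrier_mat n m \<Longrightarrow> mat_adjoint A \<in> carrier_mat m n"
  by auto

lemma index_mat_adjoint:
  "i < dim_col A \<Longrightarrow> j < dim_row A \<Longrightarrow> mat_adjoint A $$ (i, j) = cnj (A $$ (j, i))"
  unfolding mat_adjoint_def by (simp add: mat_of_rows_def)

lemma index_mult_mat_sum:
  "i < dim_row A \<Longrightarrow> j < dim_col B \<Longrightarrow> dim_col A = dim_row B \<Longrightarrow>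
    (A * B) $$ (i, j) = (\<Sum>k<dim_row B. A $$ (i, k) * B $$ (k, j))"
  by (simp add: scalar_prod_def atLeast0LessThan)

lemma mat_adjoint_mult:
  fixes A B :: "complex mat"
  assumes "dim_col A = dim_row B"
  shows "mat_adjoint (A * B) = mat_adjoint B * mat_adjoint A"
  using assms
  by (intro eq_matI) (auto simp: index_mat_adjoint index_mult_mat_sum mult.commute simp del: index_mult_mat(1))

lemma mat_adjoint_adjoint[simp]: "mat_adjoint (mat_adjoint A) = (A :: complex mat)"
  by (intro eq_matI) (auto simp: index_mat_adjoint)

lemma mat_adjoint_one[simp]: "mat_adjoint (1\<^sub>m n :: complex mat) = 1\<^sub>m n"
  by (intro eq_matI) (auto simp: index_mat_adjoint)

lemma mat_adjoint_smult: "mat_adjoint (c \<cdot>\<^sub>m A) = cnj c \<cdot>\<^sub>m mat_adjoint A"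
  by (intro eq_matI) (auto simp: index_mat_adjoint)

lemma mat_adjoint_add:
  "dim_row A = dim_row B \<Longrightarrow> dim_col A = dim_col B \<Longrightarrow>
    mat_adjoint (A + B) = mat_adjoint A + mat_adjoint (B :: complex mat)"
  by (intro eq_matI) (auto simp: index_mat_adjoint)

lemma mat_adjoint_minus:
  "dim_row A = dim_row B \<Longrightarrow> dim_col A = dim_col B \<Longrightarrow>
    mat_adjoint (A - B) = mat_adjoint A - mat_adjoint (B :: complex mat)"
  by (intro eq_matI) (auto simp: index_mat_adjoint)

section \<open>Traces, inverses and determinants\<close>

lemma mtrace_mult:
  assumes "dim_col A = dim_row B" "dim_col B = dim_row A"
  shows "mtrace (A * B) = (\<Sum>i<dim_row A. \<Sum>k<dim_row B. A $$ (i, k) * B $$ (k, i))"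
  using assms unfolding mtrace_def
  by (auto intro!: sum.cong simp: index_mult_mat_sum simp del: index_mult_mat(1))

lemma mtrace_mult_commute:
  assumes "dim_col A = dim_row B" "dim_col B = dim_row A"
  shows "mtrace (A * B) = mtrace (B * A)"
  using assms by (simp add: mtrace_mult) (subst sum.swap, simp add: mult.commute)

lemma mtrace_add: "dim_row A = dim_row B \<Longrightarrow> dim_col B = dim_row B \<Longrightarrow> mtrace (A + B) = mtrace A + mtrace B"
  by (simp add: mtrace_def sum.distrib)

lemma mtrace_minus: "dim_row A = dim_row B \<Longrightarrow> dim_col B = dim_row B \<Longrightarrow> mtrace (A - B) = mtrace A - mtrace B"
  by (simp add: mtrace_def sum_subtractf)

lemma mtrace_smult: "dim_col A = dim_row A \<Longrightarrow> mtrace (c \<cdot>\<^sub>m A) = c * mtrace A"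
  by (simp add: mtrace_def sum_distrib_left)

lemma mtrace_adjoint: "dim_col A = dim_row A \<Longrightarrow> mtrace (mat_adjoint A) = cnj (mtrace A)"
  by (simp add: mtrace_def index_mat_adjoint)

text \<open>A nonzero determinant rules out the value \<open>None\<close> of
  \<open>mat_inverse\<close>, so \<open>the\<close> in \<open>minv\<close> selects a genuine
  inverse.\<close>

lemma minv_correct:
  assumes A: "A \<in> carrier_mat n n" and det: "Determinant.det A \<noteq> 0"
  shows "A * minv A = 1\<^sub>m n" "minv A * A = 1\<^sub>m n" "minv A \<in> carrier_mat n n"
proof -
  from det_non_zero_imp_unit[OF A det, of "()"] mat_inverse(1)[OF A, of "()"]
  have "mat_inverse A \<noteq> None" by blast
  then obtain B where "mat_inverse A = Some B" by blast
  with mat_inverse(2)[OF A this]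
  show "A * minv A = 1\<^sub>m n" "minv A * A = 1\<^sub>m n" "minv A \<in> carrier_mat n n"
    by (simp_all add: minv_def)
qed

text \<open>The adjoint of a right inverse of a Hermitian matrix is a left inverse, and the two
  coincide. This is needed for the reality of the final trace.\<close>

lemma adjoint_minv_hermitian:
  assumes A: "A \<in> carrier_mat n n" and det: "Determinant.det A \<noteq> 0" and h: "mat_adjoint A = A"
  shows "mat_adjoint (minv A) = minv A"
proof -
  note inv = minv_correct[OF A det]
  have "mat_adjoint (minv A) * A = 1\<^sub>m n"
    using arg_cong[OF inv(1), of mat_adjoint] A inv(3) by (simp add: mat_adjoint_mult h)
  then have "mat_adjoint (minv A) * A * minv A = minv A"
    using inv(3) by simp
  moreover have "mat_adjoint (minv A) * A * minv A = mat_adjoint (minv A) * (A * minv A)"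
    using A inv(3) by (intro assoc_mult_mat) auto
  ultimately show ?thesis
    using inv by (metis mat_adjoint_carrier right_mult_one_mat)
qed

text \<open>With \<open>M\<close> the matrix of \<open>T\<close> and the pivots absorbed into
  \<open>D\<close>, one has A = M^H D, where M^H is upper triangular with unit diagonal and
  \<open>D\<close> is lower triangular with diagonal \<open>d\<close>.\<close>

lemma det_of_ldl:
  fixes A :: "complex mat" and T :: "nat \<Rightarrow> nat \<Rightarrow> complex"
  assumes A: "A \<in> carrier_mat n n"
    and T1: "\<And>k. k < n \<Longrightarrow> T k k = 1"
    and T0: "\<And>k j. k < n \<Longrightarrow> k < j \<Longrightarrow> T k j = 0"
    and ldl: "\<And>i j. i < n \<Longrightarrow> j < n \<Longrightarrow> A $$ (i, j) = (\<Sum>k<n. cnj (T k i) * complex_of_real (d k) * T k j)"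
  shows "Determinant.det A = complex_of_real (\<Prod>k<n. d k)"
proof -
  define M where "M = mat n n (\<lambda>(k, j). T k j)"
  define D where "D = mat n n (\<lambda>(k, j). complex_of_real (d k) * T k j)"
  have c: "M \<in> carrier_mat n n" "D \<in> carrier_mat n n" "mat_adjoint M \<in> carrier_mat n n"
    by (auto simp: M_def D_def)
  have "A = mat_adjoint M * D"
    using A by (intro eq_matI)
      (auto simp: index_mult_mat_sum ldl M_def D_def index_mat_adjoint mult.assoc simp del: index_mult_mat(1))
  then have "Determinant.det A = Determinant.det (mat_adjoint M) * Determinant.det D"
    using det_mult[OF c(3,2)] by simp
  moreover have "Determinant.det (mat_adjoint M) = 1"
    using c T1 T0 by (subst det_upper_triangular[OF _ c(3)])
      (auto simp: upper_triangular_def index_mat_adjoint M_def prod_list_diag_prod)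
  moreover have "Determinant.det D = (\<Prod>k<n. complex_of_real (d k))"
    using c T1 T0 by (subst det_lower_triangular[OF _ c(2)])
      (auto simp: D_def prod_list_diag_prod atLeast0LessThan)
  ultimately show ?thesis by simp
qed

text \<open>The form of this matrix at x is |x|^2 + b |B x|^2, hence positive definite.
  Factorisation and determinant are obtained together so that the pivots of the integral are known
  to multiply to the determinant.\<close>

lemma ldl_one_plus_gram:
  fixes B :: "complex mat"
  assumes B: "B \<in> carrier_mat m n" and b: "b \<ge> 0"
  obtains T d where "\<And>k. k < n \<Longrightarrow> d k > (0 :: real)" "\<And>k. k < n \<Longrightarrow> T k k = 1"
    "\<And>k j. k < n \<Longrightarrow> k < j \<Longrightarrow> T k j = 0"
    "\<And>i j. i < n \<Longrightarrow> j < n \<Longrightarrow> (1\<^sub>m n + complex_of_real b \<cdot>\<^sub>m (mat_adjoint B * B)) $$ (i, j)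
      = (\<Sum>k<n. cnj (T k i) * complex_of_real (d k) * T k j)"
    "Determinant.det (1\<^sub>m n + complex_of_real b \<cdot>\<^sub>m (mat_adjoint B * B)) = complex_of_real (\<Prod>k<n. d k)"
proof -
  define C where "C = 1\<^sub>m n + complex_of_real b \<cdot>\<^sub>m (mat_adjoint B * B)"
  have C: "C \<in> carrier_mat n n" using B by (intro carrier_matI) (simp_all add: C_def)
  have Cij: "C $$ (i, j) = (if i = j then 1 else 0) + complex_of_real b * (\<Sum>k<m. cnj (B $$ (k, i)) * B $$ (k, j))"
    if "i < n" "j < n" for i j
    using B that by (simp add: C_def index_mult_mat_sum index_mat_adjoint del: index_mult_mat(1))
  have "\<exists>T d. (\<forall>k<n. d k > (0::real)) \<and> (\<forall>k<n. T k k = 1) \<and> (\<forall>k<n. \<forall>j. k < j \<longrightarrow> T k j = 0) \<and>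
    (\<forall>i<n. \<forall>j<n. C $$ (i, j) = (\<Sum>k<n. cnj (T k i) * complex_of_real (d k) * T k j))"
  proof (rule ldl_decomposition)
    show "C $$ (i, j) = cnj (C $$ (j, i))" if "i < n" "j < n" for i j
      using that by (simp add: Cij mult.commute)
    show "Re (\<Sum>i<n. \<Sum>j<n. cnj (x i) * C $$ (i, j) * x j) > 0" if x: "\<exists>i<n. x i \<noteq> 0" for x
    proof -
      have "(\<Sum>i<n. \<Sum>j<n. cnj (x i) * C $$ (i, j) * x j) = (\<Sum>i<n. \<Sum>j<n. (if i = j then cnj (x i) * x j else 0)
        + (\<Sum>k<m. complex_of_real b * (cnj (B $$ (k, i) * x i) * (B $$ (k, j) * x j))))"
        by (intro sum.cong refl) (auto simp: Cij sum_distrib_left sum_distrib_right algebra_simps)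
      also have "\<dots> = (\<Sum>i<n. cnj (x i) * x i) +
        (\<Sum>i<n. \<Sum>j<n. \<Sum>k<m. complex_of_real b * (cnj (B $$ (k, i) * x i) * (B $$ (k, j) * x j)))"
        by (simp add: sum.distrib)
      also have "(\<Sum>i<n. \<Sum>j<n. \<Sum>k<m. complex_of_real b * (cnj (B $$ (k, i) * x i) * (B $$ (k, j) * x j)))
        = (\<Sum>i<n. \<Sum>k<m. \<Sum>j<n. complex_of_real b * (cnj (B $$ (k, i) * x i) * (B $$ (k, j) * x j)))"
        by (intro sum.cong refl sum.swap)
      also have "\<dots> = (\<Sum>k<m. \<Sum>i<n. \<Sum>j<n. complex_of_real b * (cnj (B $$ (k, i) * x i) * (B $$ (k, j) * x j)))"
        by (rule sum.swap)
      also have "\<dots> = (\<Sum>k<m. complex_of_real b * (cnj (\<Sum>i<n. B $$ (k, i) * x i) * (\<Sum>i<n. B $$ (k, i) * x i)))"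
        by (simp add: sum_product sum_distrib_left[symmetric])
      finally have eq: "Re (\<Sum>i<n. \<Sum>j<n. cnj (x i) * C $$ (i, j) * x j) =
        (\<Sum>i<n. (cmod (x i))\<^sup>2) + (\<Sum>k<m. b * (cmod (\<Sum>i<n. B $$ (k, i) * x i))\<^sup>2)"
        by (simp add: mult.commute[of "cnj _"] complex_norm_square[symmetric] del: of_real_power cnj_sum)
      moreover have "(\<Sum>k<m. b * (cmod (\<Sum>i<n. B $$ (k, i) * x i))\<^sup>2) \<ge> 0"
        using b by (intro sum_nonneg) auto
      moreover have "(\<Sum>i<n. (cmod (x i))\<^sup>2) > 0"
        using x by (auto intro!: sum_pos2)
      ultimately show ?thesis by linarith
    qed
  qed
  then show ?thesis
  proof (elim exE conjE)
    fix T d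
    assume *: "\<forall>k<n. d k > (0::real)" "\<forall>k<n. T k k = 1" "\<forall>k<n. \<forall>j. k < j \<longrightarrow> T k j = 0"
      "\<forall>i<n. \<forall>j<n. C $$ (i, j) = (\<Sum>k<n. cnj (T k i) * complex_of_real (d k) * T k j)"
    show thesis
    proof (rule that[where T = T and d = d])
      show "Determinant.det (1\<^sub>m n + complex_of_real b \<cdot>\<^sub>m (mat_adjoint B * B)) = complex_of_real (\<Prod>k<n. d k)"
        unfolding C_def[symmetric] by (rule det_of_ldl[OF C, of T]) (use * in simp_all)
    qed (use * in \<open>simp_all only: C_def\<close>)
  qed
qed

text \<open>The premises compare dimensions directly, so rewriting can settle them;
  \<open>carrier_mat\<close> premises would introduce dimensions that the conclusion does not
  determine.\<close>

lemma mat_dim_algebra: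
  fixes A B C :: "complex mat"
  shows assoc_mult_mat_dim: "dim_col A = dim_row B \<Longrightarrow> dim_col B = dim_row C \<Longrightarrow> (A * B) * C = A * (B * C)"
    and mult_add_mat_dim: "dim_col A = dim_row B \<Longrightarrow> dim_row B = dim_row C \<Longrightarrow> dim_col B = dim_col C \<Longrightarrow>
      A * (B + C) = A * B + A * C"
    and add_mult_mat_dim: "dim_row A = dim_row B \<Longrightarrow> dim_col A = dim_col B \<Longrightarrow> dim_col B = dim_row C \<Longrightarrow>
      (A + B) * C = A * C + B * C"
    and mult_minus_mat_dim: "dim_col A = dim_row B \<Longrightarrow> dim_row B = dim_row C \<Longrightarrow> dim_col B = dim_col C \<Longrightarrow>
      A * (B - C) = A * B - A * C"
    and minus_mult_mat_dim: "dim_row A = dim_row B \<Longrightarrow> dim_col A = dim_col B \<Longrightarrow> dim_col B = dim_row C \<Longrightarrow>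
      (A - B) * C = A * C - B * C"
    and mult_smult_mat_dim: "dim_col A = dim_row B \<Longrightarrow> A * (c \<cdot>\<^sub>m B) = c \<cdot>\<^sub>m (A * B)"
    and smult_mult_mat_dim: "dim_col A = dim_row B \<Longrightarrow> (c \<cdot>\<^sub>m A) * B = c \<cdot>\<^sub>m (A * B)"
proof -
  show "dim_col A = dim_row B \<Longrightarrow> dim_col B = dim_row C \<Longrightarrow> (A * B) * C = A * (B * C)"
    by (rule assoc_mult_mat[of _ "dim_row A" "dim_col A" _ "dim_col B" _ "dim_col C"]) auto
  show "dim_col A = dim_row B \<Longrightarrow> dim_row B = dim_row C \<Longrightarrow> dim_col B = dim_col C \<Longrightarrow>
      A * (B + C) = A * B + A * C"
    by (rule mult_add_distrib_mat[of _ "dim_row A" "dim_col A" _ "dim_col C"]) auto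
  show "dim_row A = dim_row B \<Longrightarrow> dim_col A = dim_col B \<Longrightarrow> dim_col B = dim_row C \<Longrightarrow>
      (A + B) * C = A * C + B * C"
    by (rule add_mult_distrib_mat[of _ "dim_row A" "dim_col A" _ _ "dim_col C"]) auto
  show "dim_col A = dim_row B \<Longrightarrow> dim_row B = dim_row C \<Longrightarrow> dim_col B = dim_col C \<Longrightarrow>
      A * (B - C) = A * B - A * C"
    by (rule mult_minus_distrib_mat[of _ "dim_row A" "dim_col A" _ "dim_col C"]) auto
  show "dim_row A = dim_row B \<Longrightarrow> dim_col A = dim_col B \<Longrightarrow> dim_col B = dim_row C \<Longrightarrow>
      (A - B) * C = A * C - B * C"
    by (rule minus_mult_distrib_mat[of _ "dim_row A" "dim_col A" _ _ "dim_col C"]) auto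
  show "dim_col A = dim_row B \<Longrightarrow> A * (c \<cdot>\<^sub>m B) = c \<cdot>\<^sub>m (A * B)"
    by (rule mult_smult_distrib[of _ "dim_row A" "dim_col A" _ "dim_col B"]) auto
  show "dim_col A = dim_row B \<Longrightarrow> (c \<cdot>\<^sub>m A) * B = c \<cdot>\<^sub>m (A * B)"
    by (rule mult_smult_assoc_mat[of _ "dim_row A" "dim_col A" _ "dim_col B"]) auto
qed

lemma mat_left_right_inverse_unique:
  fixes A B C :: "complex mat"
  assumes "A \<in> carrier_mat n n" "B \<in> carrier_mat n n" "C \<in> carrier_mat n n"
    and "B * A = 1\<^sub>m n" "A * C = 1\<^sub>m n"
  shows "B = C"
proof -
  have "B * A * C = B * (A * C)" using assms(1-3) by simp
  then show ?thesis using assms by simp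
qed

text \<open>Both X C and D X equal X + b X X^H X. With K = C^-1 this gives D X K = X, so D (1 - b X
  K X^H) = D - b X X^H = 1. The right inverse found this way equals the left inverse
  \<open>minv D\<close>.\<close>

lemma minv_one_plus_swap:
  fixes X :: "complex mat"
  assumes X: "X \<in> carrier_mat n n"
    and C: "C = 1\<^sub>m n + b \<cdot>\<^sub>m (mat_adjoint X * X)" "Determinant.det C \<noteq> 0"
    and D: "D = 1\<^sub>m n + b \<cdot>\<^sub>m (X * mat_adjoint X)" "Determinant.det D \<noteq> 0"
  shows "minv D = 1\<^sub>m n - b \<cdot>\<^sub>m (X * minv C * mat_adjoint X)"
proof -
  have cC: "C \<in> carrier_mat n n" and cD: "D \<in> carrier_mat n n"
    using X by (auto simp: C D intro!: carrier_matI)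
  define K where "K = minv C"
  note K = minv_correct[OF cC C(2), folded K_def]
  have dims: "dim_row X = n" "dim_col X = n" "dim_row K = n" "dim_col K = n"
    using X K(3) by auto
  define Y where "Y = 1\<^sub>m n - b \<cdot>\<^sub>m (X * K * mat_adjoint X)"
  have cY: "Y \<in> carrier_mat n n" using X K(3) by (auto simp: Y_def intro!: carrier_matI)
  have "X * C = D * X"
    using dims by (simp add: C(1) D(1) assoc_mult_mat_dim mult_add_mat_dim add_mult_mat_dim mult_smult_mat_dim
        smult_mult_mat_dim right_mult_one_mat[OF X] left_mult_one_mat[OF X])
  then have "D * X * K = X * (C * K)"
    using X K(3) cC cD by (metis assoc_mult_mat)
  then have DXK: "D * X * K = X" using K(1) X by simp
  have "D * Y = D - b \<cdot>\<^sub>m (D * X * K * mat_adjoint X)"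
    using dims cD unfolding Y_def
    by (simp add: assoc_mult_mat_dim mult_minus_mat_dim mult_smult_mat_dim right_mult_one_mat[OF cD])
  also have "\<dots> = D - b \<cdot>\<^sub>m (X * mat_adjoint X)"
    unfolding DXK ..
  also have "\<dots> = 1\<^sub>m n"
    unfolding D(1) using X by (intro eq_matI) auto
  finally have "D * Y = 1\<^sub>m n" .
  with mat_left_right_inverse_unique[OF cD minv_correct(3)[OF cD D(2)] cY minv_correct(2)[OF cD D(2)]]
  show ?thesis by (simp add: Y_def K_def)
qed

section \<open>Traces involving the puncturing matrix\<close>

lemma mtrace_one: "mtrace (1\<^sub>m n) = of_nat n"
  by (simp add: mtrace_def)

lemma mtrace_four_block_diag:
  assumes "A \<in> carrier_mat a a" "D \<in> carrier_mat b b"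
  shows "mtrace (four_block_mat A (0\<^sub>m a b) (0\<^sub>m b a) D) = mtrace A + mtrace D"
proof -
  have "(\<Sum>i<a + b. f i) = (\<Sum>i<a. f i) + (\<Sum>i<b. f (a + i))" for f :: "nat \<Rightarrow> complex"
    by (induction b) (simp_all add: add.assoc)
  then show ?thesis
    using assms by (simp add: mtrace_def)
qed

text \<open>The rows of \<open>W_p\<close> have norm 1 but need not be orthogonal, so the Gram
  matrix in general agrees with the identity only on the diagonal, hence in trace.\<close>

lemma W_p_gram:
  assumes L: "L \<in> carrier_mat n n" and \<nu>: "\<nu> \<le> n" and lower: "lower_triangular L"
    and diag: "\<And>i. i < n \<Longrightarrow> L $$ (i, i) \<noteq> 0"
  shows "W_p \<nu> L \<in> carrier_mat n n" and "mtrace (W_p \<nu> L * mat_adjoint (W_p \<nu> L)) = of_nat n"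
proof -
  define r where "r = n - \<nu>"
  define S where "S = lr_block \<nu> L"
  define V where "V = minv S"
  define X where "X = Sigma_mat S * V"
  have S: "S \<in> carrier_mat r r" using L by (auto simp: S_def lr_block_def r_def)
  \<comment> \<open>\<open>S\<close> inherits triangularity from \<open>L\<close>, and its diagonal
    is the tail of the diagonal of \<open>L\<close>, so it is invertible.\<close>
  have "Determinant.det S = (\<Prod>i<r. S $$ (i, i))"
    using S L lower \<nu> by (subst det_lower_triangular[OF _ S])
      (auto simp: S_def lr_block_def r_def lower_triangular_def prod_list_diag_prod atLeast0LessThan)
  also have "\<dots> \<noteq> 0"
    using L diag by (auto simp: S_def lr_block_def r_def)
  finally have det: "Determinant.det S \<noteq> 0" .
  note V = minv_correct[OF S det, folded V_def]
  have Sig: "Sigma_mat S \<in> carrier_mat r r" using S by (simp add: Sigma_mat_def Let_def)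
  have X: "X \<in> carrier_mat r r" using Sig V(3) by (simp add: X_def)
  have W: "W_p \<nu> L = four_block_mat (1\<^sub>m \<nu>) (0\<^sub>m \<nu> r) (0\<^sub>m r \<nu>) X"
    using S by (simp add: W_p_def Let_def S_def[symmetric] X_def V_def)
  then show "W_p \<nu> L \<in> carrier_mat n n"
    using X \<nu> by (auto simp: r_def intro!: carrier_matI)
  have "mat_adjoint (W_p \<nu> L) = four_block_mat (1\<^sub>m \<nu>) (0\<^sub>m \<nu> r) (0\<^sub>m r \<nu>) (mat_adjoint X)"
    unfolding W using X by (intro eq_matI) (auto simp: index_mat_adjoint)
  then have "W_p \<nu> L * mat_adjoint (W_p \<nu> L) =
      four_block_mat (1\<^sub>m \<nu>) (0\<^sub>m \<nu> r) (0\<^sub>m r \<nu>) (X * mat_adjoint X)"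
    unfolding W using X mat_adjoint_carrier[OF X]
    by (simp add: mult_four_block_mat[of _ \<nu> \<nu> _ r _ r _ _ \<nu> _ r])
  then have "mtrace (W_p \<nu> L * mat_adjoint (W_p \<nu> L)) = of_nat \<nu> + mtrace (X * mat_adjoint X)"
    using mtrace_four_block_diag[of "1\<^sub>m \<nu>" \<nu> "X * mat_adjoint X" r] X mat_adjoint_carrier[OF X]
    by (simp add: mtrace_one)
  also have "mtrace (X * mat_adjoint X) = (\<Sum>i<r. 1)"
  proof -
    have "(\<Sum>k<r. X $$ (i, k) * cnj (X $$ (i, k))) = 1" if i: "i < r" for i
    proof -
      \<comment> \<open>The squared norm of row \<open>i\<close> of S^-1; \<open>Sigma_mat\<close>
        divides that row by its square root.\<close>
      define D where "D = Re ((V * mat_adjoint V) $$ (i, i))"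
      have "(V * mat_adjoint V) $$ (i, i) = (\<Sum>k<r. V $$ (i, k) * cnj (V $$ (i, k)))"
        using V(3) i by (simp add: index_mult_mat_sum index_mat_adjoint del: index_mult_mat(1))
      also have "\<dots> = complex_of_real (\<Sum>k<r. (cmod (V $$ (i, k)))\<^sup>2)"
        by (simp add: complex_norm_square del: of_real_power)
      finally have D: "D = (\<Sum>k<r. (cmod (V $$ (i, k)))\<^sup>2)" by (simp add: D_def)
      \<comment> \<open>A zero row of \<open>V\<close> would make the diagonal entry of
        \<open>V * S = 1\<close> vanish. So \<open>D\<close> is positive and the scaling is a true
        normalisation.\<close>
      have "\<exists>k<r. V $$ (i, k) \<noteq> 0"
      proof (rule ccontr)
        assume "\<not> ?thesis"
        then have "(V * S) $$ (i, i) = 0"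
          using V(3) S i by (simp add: index_mult_mat_sum del: index_mult_mat(1))
        then show False using V(2) i by simp
      qed
      then have Dpos: "D > 0" unfolding D by (auto intro!: sum_pos2)
      have Xik: "X $$ (i, k) = complex_of_real (1 / sqrt D) * V $$ (i, k)" if k: "k < r" for k
      proof -
        have "X $$ (i, k) = (\<Sum>l<r. (if i = l then complex_of_real (1 / sqrt D) else 0) * V $$ (l, k))"
          using Sig V(3) S i k unfolding X_def
          by (simp add: index_mult_mat_sum del: index_mult_mat(1))
            (auto intro!: sum.cong simp: Sigma_mat_def Let_def V_def D_def)
        also have "\<dots> = (\<Sum>l<r. if i = l then complex_of_real (1 / sqrt D) * V $$ (l, k) else 0)"
          by (intro sum.cong) auto
        finally show ?thesis using i by simp
      qed
      have "(\<Sum>k<r. X $$ (i, k) * cnj (X $$ (i, k))) =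
        (\<Sum>k<r. complex_of_real (1 / D * (cmod (V $$ (i, k)))\<^sup>2))"
      proof (intro sum.cong refl)
        fix k assume "k \<in> {..<r}"
        then have "X $$ (i, k) * cnj (X $$ (i, k)) =
          complex_of_real (1 / sqrt D) * complex_of_real (1 / sqrt D) * (V $$ (i, k) * cnj (V $$ (i, k)))"
          by (simp add: Xik)
        also have "\<dots> = complex_of_real (1 / sqrt D * (1 / sqrt D)) * complex_of_real ((cmod (V $$ (i, k)))\<^sup>2)"
          unfolding complex_norm_square of_real_mult ..
        also have "1 / sqrt D * (1 / sqrt D) = 1 / D" using Dpos by simp
        finally show "X $$ (i, k) * cnj (X $$ (i, k)) = complex_of_real (1 / D * (cmod (V $$ (i, k)))\<^sup>2)"
          by simp
      qed
      also have "\<dots> = complex_of_real (1 / D * D)"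
        unfolding of_real_sum[symmetric] sum_distrib_left[symmetric] D[symmetric] ..
      finally show ?thesis using Dpos by simp
    qed
    then show ?thesis
      using X by (simp add: mtrace_mult index_mat_adjoint del: index_mult_mat(1))
  qed
  finally show "mtrace (W_p \<nu> L * mat_adjoint (W_p \<nu> L)) = of_nat n"
    using \<nu> by (simp add: r_def flip: of_nat_add)
qed

text \<open>Inserting the formula for \<open>minv D\<close> and expanding leaves n - tr V, which is
  0, and two traces. Cyclicity brings both to the form tr (K ...) with K = C^-1, which is how they
  arise from the expectations.\<close>

lemma mtrace_one_minus_gram_minv:
  fixes X V :: "complex mat"
  assumes X: "X \<in> carrier_mat n n" and V: "V \<in> carrier_mat n n" and trV: "mtrace V = of_nat n"
    and C: "C = 1\<^sub>m n + b \<cdot>\<^sub>m (mat_adjoint X * X)" "Determinant.det C \<noteq> 0"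
    and D: "D = 1\<^sub>m n + b \<cdot>\<^sub>m (X * mat_adjoint X)" "Determinant.det D \<noteq> 0"
  shows "mtrace ((1\<^sub>m n - V) * minv D) =
    mtrace (minv C) - of_nat n + b * mtrace (minv C * (mat_adjoint X * V * X))"
proof -
  define K where "K = minv C"
  define Y where "Y = mat_adjoint X"
  have cC: "C \<in> carrier_mat n n" using X by (auto simp: C intro!: carrier_matI)
  note K = minv_correct[OF cC C(2), folded K_def]
  have Y: "Y \<in> carrier_mat n n" using X by (auto simp: Y_def)
  have dims[simp]: "dim_row X = n" "dim_col X = n" "dim_row Y = n" "dim_col Y = n" "dim_row K = n" "dim_col K = n"
    "dim_row V = n" "dim_col V = n"
    using X Y K(3) V by auto
  have V1: "V * 1\<^sub>m n = V" using V by simp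
  have "(1\<^sub>m n - V) * minv D = (1\<^sub>m n - b \<cdot>\<^sub>m (X * K * Y)) - (V - b \<cdot>\<^sub>m (V * (X * K * Y)))"
    unfolding minv_one_plus_swap[OF X C D] K_def[symmetric] Y_def[symmetric]
  proof -
    have "(1\<^sub>m n - V) * (1\<^sub>m n - b \<cdot>\<^sub>m (X * K * Y)) =
      (1\<^sub>m n - b \<cdot>\<^sub>m (X * K * Y)) - V * (1\<^sub>m n - b \<cdot>\<^sub>m (X * K * Y))"
      by (subst minus_mult_mat_dim) simp_all
    also have "V * (1\<^sub>m n - b \<cdot>\<^sub>m (X * K * Y)) = V - b \<cdot>\<^sub>m (V * (X * K * Y))"
      by (subst mult_minus_mat_dim) (simp_all add: mult_smult_mat_dim V1)
    finally show "(1\<^sub>m n - V) * (1\<^sub>m n - b \<cdot>\<^sub>m (X * K * Y)) =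
      1\<^sub>m n - b \<cdot>\<^sub>m (X * K * Y) - (V - b \<cdot>\<^sub>m (V * (X * K * Y)))" .
  qed
  then have 1: "mtrace ((1\<^sub>m n - V) * minv D) =
    of_nat n - b * mtrace (X * K * Y) - (of_nat n - b * mtrace (V * (X * K * Y)))"
    by (simp add: mtrace_minus mtrace_smult mtrace_one trV)
  \<comment> \<open>The trace of this identity, whose left side is 1, trades b tr (K X^H X) for n -
    tr K.\<close>
  have "K * C = K + b \<cdot>\<^sub>m (K * (Y * X))"
    using K(3) by (simp add: C(1) Y_def[symmetric] mult_add_mat_dim mult_smult_mat_dim)
  with K(2) have "mtrace K + b * mtrace (K * (Y * X)) = of_nat n"
    by (metis (no_types) dims(3) dims(2) dims(5) dims(6) index_mult_mat(2,3) index_smult_mat(2,3) mtrace_add mtrace_one mtrace_smult)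
  moreover have "mtrace (X * K * Y) = mtrace (K * (Y * X))"
    using mtrace_mult_commute[of X "K * Y"] by (simp add: assoc_mult_mat_dim)
  moreover have "mtrace (V * (X * K * Y)) = mtrace (K * (Y * V * X))"
    using mtrace_mult_commute[of "V * X" "K * Y"] by (simp add: assoc_mult_mat_dim)
  ultimately show ?thesis
    unfolding 1 K_def[symmetric] Y_def[symmetric] by (simp add: algebra_simps)
qed

lemma det_one_plus_gram:
  fixes B :: "complex mat"
  assumes "B \<in> carrier_mat m n" "b \<ge> 0"
  shows "Determinant.det (1\<^sub>m n + complex_of_real b \<cdot>\<^sub>m (mat_adjoint B * B)) \<noteq> 0"
proof -
  from ldl_one_plus_gram[OF assms] obtain d where "\<And>k. k < n \<Longrightarrow> d k > (0 :: real)"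
    "Determinant.det (1\<^sub>m n + complex_of_real b \<cdot>\<^sub>m (mat_adjoint B * B)) = complex_of_real (\<Prod>k<n. d k)"
    by metis
  moreover from this(1) have "(\<Prod>k<n. d k) > 0" by (intro prod_pos) auto
  ultimately show ?thesis by (metis less_irrefl of_real_eq_0_iff)
qed

section \<open>The mismatched marginal and the expectations\<close>

text \<open>The exponent of the prior adds I / s to G, so the quadratic form has matrix A = I / s +
  G = C / s with pivots d_k / s. The linear term is governed by b = F^H y, and the maximiser of the
  exponent is u = s K b.\<close>

lemma pp_marg_eq:
  fixes F G :: "complex mat" and y :: "nat \<Rightarrow> complex"
  assumes s: "s > 0" and F: "F \<in> carrier_mat m n" and G: "G \<in> carrier_mat n n"
    and d: "\<And>k. k < n \<Longrightarrow> d k > 0" and T1: "\<And>k. k < n \<Longrightarrow> T k k = 1"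
    and T0: "\<And>k j. k < n \<Longrightarrow> k < j \<Longrightarrow> T k j = 0"
    and ldl: "\<And>i j. i < n \<Longrightarrow> j < n \<Longrightarrow> (1\<^sub>m n + complex_of_real s \<cdot>\<^sub>m G) $$ (i, j)
      = (\<Sum>k<n. cnj (T k i) * complex_of_real (d k) * T k j)"
    and K: "K \<in> carrier_mat n n" "(1\<^sub>m n + complex_of_real s \<cdot>\<^sub>m G) * K = 1\<^sub>m n"
  shows "pp_marg F G s y =
    exp (s * Re (sesq (F * K * mat_adjoint F) y y)) / (\<Prod>k<n. d k)"
proof -
  define C where "C = 1\<^sub>m n + complex_of_real s \<cdot>\<^sub>m G"
  have C: "C \<in> carrier_mat n n" using G by (simp add: C_def)
  define b where "b i = (\<Sum>k<m. cnj (F $$ (k, i)) * y k)" for i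
  define u where "u i = complex_of_real s * (\<Sum>j<n. K $$ (i, j) * b j)" for i
  define A where "A i j = C $$ (i, j) / complex_of_real s" for i j
  have Au: "(\<Sum>j<n. A i j * u j) = b i" if i: "i < n" for i
  proof -
    have "(\<Sum>j<n. A i j * u j) = (\<Sum>j<n. \<Sum>l<n. C $$ (i, j) * K $$ (j, l) * b l)"
      using s by (simp add: A_def u_def sum_distrib_left mult.assoc)
    also have "\<dots> = (\<Sum>l<n. (C * K) $$ (i, l) * b l)"
      using C K(1) i by (subst sum.swap)
        (simp add: index_mult_mat_sum sum_distrib_right del: index_mult_mat(1))
    also have "\<dots> = (\<Sum>l<n. if l = i then b l else 0)"
      unfolding K(2)[folded C_def] using i by (intro sum.cong) auto
    finally show ?thesis using i by simp
  qed
  have bu: "(\<Sum>i<n. cnj (b i) * u i) = complex_of_real s * sesq (F * K * mat_adjoint F) y y"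
  proof -
    have e: "(F * K * mat_adjoint F) $$ (p, q) = (\<Sum>i<n. \<Sum>j<n. F $$ (p, i) * K $$ (i, j) * cnj (F $$ (q, j)))"
      if "p < m" "q < m" for p q
      using that F K(1) by (subst sum.swap)
        (simp add: index_mult_mat_sum index_mat_adjoint sum_distrib_right del: index_mult_mat(1))
    let ?f = "\<lambda>p q i j. cnj (y p) * F $$ (p, i) * K $$ (i, j) * cnj (F $$ (q, j)) * y q"
    have "sesq (F * K * mat_adjoint F) y y = (\<Sum>p<m. \<Sum>q<m. \<Sum>i<n. \<Sum>j<n. ?f p q i j)"
      using F K(1) unfolding sesq_def
      by (simp add: e sum_distrib_left sum_distrib_right mult.assoc del: index_mult_mat(1))
    also have "\<dots> = (\<Sum>p<m. \<Sum>i<n. \<Sum>q<m. \<Sum>j<n. ?f p q i j)"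
      by (intro sum.cong refl sum.swap)
    also have "\<dots> = (\<Sum>i<n. \<Sum>p<m. \<Sum>j<n. \<Sum>q<m. ?f p q i j)"
      by (subst sum.swap) (intro sum.cong refl sum.swap)
    also have "\<dots> = (\<Sum>i<n. \<Sum>j<n. \<Sum>p<m. \<Sum>q<m. ?f p q i j)"
      by (intro sum.cong refl sum.swap)
    also have "\<dots> = (\<Sum>i<n. \<Sum>j<n. cnj (b i) * K $$ (i, j) * b j)"
    proof (intro sum.cong refl)
      fix i j
      have "cnj (b i) * K $$ (i, j) * b j = K $$ (i, j) * (cnj (b i) * b j)" by simp
      also have "\<dots> = K $$ (i, j) * (\<Sum>p<m. \<Sum>q<m. F $$ (p, i) * cnj (y p) * (cnj (F $$ (q, j)) * y q))"
        unfolding b_def by (simp add: sum_product)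
      finally show "(\<Sum>p<m. \<Sum>q<m. ?f p q i j) = cnj (b i) * K $$ (i, j) * b j"
        by (simp add: sum_distrib_left mult_ac)
    qed
    finally show ?thesis
      by (simp add: u_def sum_distrib_left mult_ac)
  qed
  have sF: "sesq F y x = (\<Sum>i<n. cnj (b i) * x i)" for x
  proof -
    have "sesq F y x = (\<Sum>i<m. \<Sum>j<n. cnj (y i) * F $$ (i, j) * x j)"
      using F by (simp add: sesq_def)
    also have "\<dots> = (\<Sum>j<n. \<Sum>i<m. cnj (y i) * F $$ (i, j) * x j)"
      by (rule sum.swap)
    also have "\<dots> = (\<Sum>j<n. cnj (b j) * x j)"
      unfolding b_def cnj_sum sum_distrib_right by (intro sum.cong refl) simp
    finally show ?thesis .
  qed
  \<comment> \<open>The diagonal part of C / s is the exponent of the prior and the rest is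
    G.\<close>
  have sG: "complex_of_real ((\<Sum>i<n. (cmod (x i))\<^sup>2) / s) + sesq G x x = (\<Sum>i<n. \<Sum>j<n. cnj (x i) * A i j * x j)" for x
  proof -
    have "(\<Sum>i<n. \<Sum>j<n. cnj (x i) * A i j * x j) =
      (\<Sum>i<n. \<Sum>j<n. (if i = j then cnj (x i) * x j / complex_of_real s else 0) + cnj (x i) * G $$ (i, j) * x j)"
      using G s by (intro sum.cong refl) (auto simp: A_def C_def field_simps)
    also have "\<dots> = (\<Sum>i<n. cnj (x i) * x i) / complex_of_real s + sesq G x x"
      using G by (simp add: sum.distrib sesq_def sum_divide_distrib)
    also have "(\<Sum>i<n. cnj (x i) * x i) = complex_of_real (\<Sum>i<n. (cmod (x i))\<^sup>2)"
      by (simp add: complex_norm_square mult.commute del: of_real_power)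
    finally show ?thesis by simp
  qed
  have *: "cn_density n s x * pp_cond F G y x = (1 / (pi * s)) ^ n *
    exp (2 * Re (\<Sum>i<n. cnj (b i) * x i) - Re (\<Sum>i<n. \<Sum>j<n. cnj (x i) * A i j * x j))" for x
    unfolding cn_density_def pp_cond_def sF sG[symmetric]
    by (simp add: exp_add[symmetric] exp_diff exp_minus field_simps)
  have meas: "(\<lambda>x. pp_cond F G y x) \<in> borel_measurable (Cspace n)"
    unfolding pp_cond_def sesq_def using F G
    by (intro borel_measurable_sum borel_measurable_times measurable_Cspace_component borel_measurable_const
      borel_measurable_diff measurable_compose[OF _ borel_measurable_exp] measurable_compose[OF _ borel_measurable_Re]
      borel_measurable_cnj) auto
  have "pp_marg F G s y = (\<integral>x. cn_density n s x * pp_cond F G y x \<partial>Cspace n)"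
    using G s meas unfolding pp_marg_def prior_def
    by (subst integral_density) (auto simp: cn_density_nonneg)
  \<comment> \<open>The integrand is nonnegative, so the Bochner integral can be read off from the
    nonnegative one with no prior knowledge of integrability.\<close>
  also have "\<dots> = enn2real (\<integral>\<^sup>+x. ennreal (cn_density n s x * pp_cond F G y x) \<partial>Cspace n)"
    using s meas by (subst integral_eq_nn_integral) (auto simp: cn_density_nonneg pp_cond_def)
  also have "(\<integral>\<^sup>+x. ennreal (cn_density n s x * pp_cond F G y x) \<partial>Cspace n) =
    (\<integral>\<^sup>+x. ennreal ((1 / (pi * s)) ^ n) * ennreal (exp (2 * Re (\<Sum>i<n. cnj (b i) * x i)
      - Re (\<Sum>i<n. \<Sum>j<n. cnj (x i) * A i j * x j))) \<partial>Cspace n)"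
    unfolding * using s by (simp add: ennreal_mult)
  also have "\<dots> = ennreal ((1 / (pi * s)) ^ n) * (\<integral>\<^sup>+x. ennreal (exp (2 * Re (\<Sum>i<n. cnj (b i) * x i)
      - Re (\<Sum>i<n. \<Sum>j<n. cnj (x i) * A i j * x j))) \<partial>Cspace n)"
    by (intro nn_integral_cmult measurable_compose[OF _ measurable_ennreal] borel_measurable_sum
      borel_measurable_times measurable_Cspace_component borel_measurable_const
      borel_measurable_diff measurable_compose[OF _ borel_measurable_exp] measurable_compose[OF _ borel_measurable_Re]
      borel_measurable_cnj) auto
  also have "(\<integral>\<^sup>+x. ennreal (exp (2 * Re (\<Sum>i<n. cnj (b i) * x i)
      - Re (\<Sum>i<n. \<Sum>j<n. cnj (x i) * A i j * x j))) \<partial>Cspace n)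
    = ennreal (exp (Re (\<Sum>i<n. cnj (b i) * u i)) * (\<Prod>k<n. pi / (d k / s)))"
  proof (rule nn_integral_gaussian_quadratic[of n "\<lambda>k. d k / s" T A u b])
    show "A i j = (\<Sum>k<n. cnj (T k i) * complex_of_real (d k / s) * T k j)" if "i < n" "j < n" for i j
      using ldl[OF that] by (simp add: A_def C_def sum_divide_distrib)
  qed (use d s T1 T0 Au in auto)
  also have "enn2real (ennreal ((1 / (pi * s)) ^ n) *
      ennreal (exp (Re (\<Sum>i<n. cnj (b i) * u i)) * (\<Prod>k<n. pi / (d k / s)))) =
    (1 / (pi * s)) ^ n * (exp (Re (\<Sum>i<n. cnj (b i) * u i)) * (\<Prod>k<n. pi / (d k / s)))"
  proof -
    have "(\<Prod>k<n. pi / (d k / s)) \<ge> 0"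
      using d s by (intro prod_nonneg) (auto simp: less_imp_le)
    then show ?thesis using s by (simp add: ennreal_mult[symmetric])
  qed
  \<comment> \<open>Each factor pi s / d_k meets one factor 1 / (pi s) of the normalisation of the
    prior, leaving 1 / d_k.\<close>
  also have "\<dots> = exp (Re (\<Sum>i<n. cnj (b i) * u i)) / (\<Prod>k<n. d k)"
    using s by (simp add: prod_dividef prod.distrib field_simps)
  finally show ?thesis by (simp add: bu)
qed

section \<open>The joint law of input and output\<close>

lemma finite_measure_prior:
  assumes "s > 0"
  shows "finite_measure (prior n s)"
proof (rule finite_measureI)
  have "integrable (prior n s) (\<lambda>_. 1 :: complex)"
    using has_bochner_integral_prior_one[OF assms] by (rule integrable.intros)
  then have "(\<integral>\<^sup>+x. ennreal (norm (1 :: complex)) \<partial>prior n s) < \<infinity>"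
    by (simp add: integrable_iff_bounded)
  then show "emeasure (prior n s) (space (prior n s)) \<noteq> \<infinity>"
    by (simp add: less_top[symmetric])
qed

lemma sets_prior[measurable_cong, simp]: "sets (prior n s) = sets (Cspace n)"
  by (simp add: prior_def)

lemma pair_sigma_finite_prior:
  assumes "s > 0" "t > 0"
  shows "pair_sigma_finite (prior n s) (prior m t)"
  using finite_measure_prior[OF assms(1), of n] finite_measure_prior[OF assms(2), of m]
  by (simp add: pair_sigma_finite_def finite_measure.axioms(1))

text \<open>The noise law has the same shape as that of the signal, so it is again a
  \<open>prior\<close>, with \<open>N0\<close> as variance. Moments of (x, y) can then be pulled
  back to independent x and z.\<close>

lemma joint_xy_eq_distr:
  assumes "Es > 0" "N0 > 0"
  shows "joint_xy H Es N0 = distr (prior (dim_col H) Es \<Otimes>\<^sub>M prior (dim_row H) N0)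
    (Cspace (dim_col H) \<Otimes>\<^sub>M Cspace (dim_row H)) (\<lambda>(x, z). (x, channel H x z))"
proof -
  have "prior (dim_col H) Es \<Otimes>\<^sub>M prior (dim_row H) N0 =
    density (Cspace (dim_col H) \<Otimes>\<^sub>M Cspace (dim_row H))
      (\<lambda>(x, z). ennreal (cn_density (dim_col H) Es x) * ennreal (cn_density (dim_row H) N0 z))"
    unfolding prior_def using finite_measure_prior[OF assms(2), of "dim_row H"]
    by (intro pair_measure_density) (auto simp: sigma_finite_Cspace finite_measure.axioms(1) prior_def)
  then show ?thesis
    using assms by (simp add: joint_xy_def ennreal_mult cn_density_nonneg)
qed

lemma measurable_channel:
  "(\<lambda>(x, z). (x, channel H x z)) \<in>
    prior (dim_col H) s \<Otimes>\<^sub>M prior (dim_row H) t \<rightarrow>\<^sub>M Cspace (dim_col H) \<Otimes>\<^sub>M Cspace (dim_row H)"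
proof -
  let ?M = "Cspace (dim_col H) \<Otimes>\<^sub>M Cspace (dim_row H)"
  have c: "(\<lambda>p. (\<Sum>j<dim_col H. H $$ (i, j) * fst p j) + snd p i) \<in> borel_measurable ?M" if "i < dim_row H" for i
    using that by (intro borel_measurable_add borel_measurable_sum borel_measurable_times
      borel_measurable_const measurable_compose[OF measurable_fst measurable_Cspace_component]
      measurable_compose[OF measurable_snd measurable_Cspace_component]) auto
  have "(\<lambda>p. channel H (fst p) (snd p)) \<in> ?M \<rightarrow>\<^sub>M Cspace (dim_row H)"
    unfolding channel_def Cspace_def[of "dim_row H"] using c
    by (intro measurable_restrict) (auto simp: Cspace_def)
  then show ?thesis
    by (simp add: case_prod_beta measurable_Pair cong: measurable_cong_sets sets_pair_measure_cong)
qed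

lemma has_bochner_integral_joint_xyI:
  fixes f :: "_ \<Rightarrow> complex"
  assumes "Es > 0" "N0 > 0"
    and "f \<in> borel_measurable (Cspace (dim_col H) \<Otimes>\<^sub>M Cspace (dim_row H))"
    and "has_bochner_integral (prior (dim_col H) Es \<Otimes>\<^sub>M prior (dim_row H) N0)
      (\<lambda>p. f (fst p, channel H (fst p) (snd p))) v"
  shows "has_bochner_integral (joint_xy H Es N0) f v"
  unfolding joint_xy_eq_distr[OF assms(1,2)] using assms(3,4)
  by (intro has_bochner_integral_distr measurable_channel) (auto simp: case_prod_beta)

section \<open>Second moments of the joint law\<close>

lemma borel_measurable_fst_component: "i < n \<Longrightarrow> (\<lambda>w. fst w i) \<in> borel_measurable (Cspace n \<Otimes>\<^sub>M M)"
  by (intro measurable_compose[OF measurable_fst measurable_Cspace_component])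

lemma borel_measurable_snd_component: "i < m \<Longrightarrow> (\<lambda>w. snd w i) \<in> borel_measurable (M \<Otimes>\<^sub>M Cspace m)"
  by (intro measurable_compose[OF measurable_snd measurable_Cspace_component])

text \<open>Linearity reduces every later expectation of a form to the entrywise second moments
  \<open>R\<close>.\<close>

lemma has_bochner_integral_sesq:
  assumes "A \<in> carrier_mat p q"
    and "\<And>i j. i < p \<Longrightarrow> j < q \<Longrightarrow> has_bochner_integral M (\<lambda>w. cnj (f w i) * g w j) (R i j)"
  shows "has_bochner_integral M (\<lambda>w. sesq A (f w) (g w)) (\<Sum>i<p. \<Sum>j<q. A $$ (i, j) * R i j)"
proof -
  have "has_bochner_integral M (\<lambda>w. \<Sum>i<p. \<Sum>j<q. A $$ (i, j) * (cnj (f w i) * g w j))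
    (\<Sum>i<p. \<Sum>j<q. A $$ (i, j) * R i j)"
    by (intro has_bochner_integral_sum has_bochner_integral_mult_right assms(2)) auto
  then show ?thesis using assms(1) by (simp add: sesq_def mult_ac)
qed

context
  fixes H :: "complex mat" and m n :: nat and Es N0 :: real
  assumes H: "H \<in> carrier_mat m n" and Es: "Es > 0" and N0: "N0 > 0"
begin

lemma dim_H: "dim_row H = m" "dim_col H = n"
  using H by auto

interpretation P: pair_sigma_finite "prior n Es" "prior m N0"
  by (rule pair_sigma_finite_prior) (rule Es N0)+

lemmas pair_moment = P.has_bochner_integral_pair_mult

lemma has_bochner_integral_joint_one: "has_bochner_integral (joint_xy H Es N0) (\<lambda>_. 1 :: complex) 1"
proof (rule has_bochner_integral_joint_xyI[OF Es N0], unfold dim_H)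
  show "has_bochner_integral (prior n Es \<Otimes>\<^sub>M prior m N0) (\<lambda>_. 1 :: complex) 1"
    using pair_moment[OF has_bochner_integral_prior_one[OF Es] has_bochner_integral_prior_one[OF N0]] by simp
qed simp

lemma has_bochner_integral_joint_xx:
  assumes ij: "i < n" "j < n"
  shows "has_bochner_integral (joint_xy H Es N0) (\<lambda>w. cnj (fst w i) * fst w j)
    (if i = j then complex_of_real Es else 0)"
proof (rule has_bochner_integral_joint_xyI[OF Es N0], unfold dim_H)
  show "(\<lambda>w. cnj (fst w i) * fst w j) \<in> borel_measurable (Cspace n \<Otimes>\<^sub>M Cspace m)"
    using ij by (intro borel_measurable_times borel_measurable_cnj borel_measurable_fst_component)
  show "has_bochner_integral (prior n Es \<Otimes>\<^sub>M prior m N0)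
      (\<lambda>p. cnj (fst (fst p, channel H (fst p) (snd p)) i) * fst (fst p, channel H (fst p) (snd p)) j)
      (if i = j then complex_of_real Es else 0)"
    using pair_moment[OF has_bochner_integral_prior_covariance[OF Es ij] has_bochner_integral_prior_one[OF N0]]
    by simp
qed

lemma has_bochner_integral_joint_yx:
  assumes ij: "i < m" "j < n"
  shows "has_bochner_integral (joint_xy H Es N0) (\<lambda>w. cnj (snd w i) * fst w j)
    (complex_of_real Es * cnj (H $$ (i, j)))"
proof (rule has_bochner_integral_joint_xyI[OF Es N0], unfold dim_H)
  show "(\<lambda>w. cnj (snd w i) * fst w j) \<in> borel_measurable (Cspace n \<Otimes>\<^sub>M Cspace m)"
    using ij by (intro borel_measurable_times borel_measurable_cnj borel_measurable_fst_component
      borel_measurable_snd_component)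
  \<comment> \<open>Each summand is arranged as a function of x times a function of z, with 1 as a
    trivial noise factor where necessary. The values on the right keep this factored shape to match
    \<open>pair_moment\<close>.\<close>
  have hb: "has_bochner_integral (prior n Es \<Otimes>\<^sub>M prior m N0)
    (\<lambda>p. (\<Sum>k<n. cnj (H $$ (i, k)) * ((cnj (fst p k) * fst p j) * 1)) + fst p j * cnj (snd p i))
    ((\<Sum>k<n. cnj (H $$ (i, k)) * ((if k = j then complex_of_real Es else 0) * 1)) + 0 * cnj 0)"
    using ij by (intro has_bochner_integral_add has_bochner_integral_sum has_bochner_integral_mult_right
      pair_moment has_bochner_integral_prior_covariance has_bochner_integral_prior_one
      has_bochner_integral_prior_mean has_bochner_integral_cnj Es N0) auto
  have value_eq: "(\<Sum>k<n. cnj (H $$ (i, k)) * ((if k = j then complex_of_real Es else 0) * 1)) + 0 * cnj 0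
    = complex_of_real Es * cnj (H $$ (i, j))"
    using ij by (simp add: if_distrib[of "\<lambda>x. _ * x"] cong: if_cong)
  have integrand_eq: "(\<Sum>k<n. cnj (H $$ (i, k)) * ((cnj (fst p k) * fst p j) * 1)) + fst p j * cnj (snd p i) =
    cnj (snd (fst p, channel H (fst p) (snd p)) i) * fst (fst p, channel H (fst p) (snd p)) j"
    for p :: "(nat \<Rightarrow> complex) \<times> (nat \<Rightarrow> complex)"
    using ij by (simp add: channel_def dim_H sum_distrib_left sum_distrib_right algebra_simps)
  show "has_bochner_integral (prior n Es \<Otimes>\<^sub>M prior m N0)
      (\<lambda>p. cnj (snd (fst p, channel H (fst p) (snd p)) i) * fst (fst p, channel H (fst p) (snd p)) j)
      (complex_of_real Es * cnj (H $$ (i, j)))"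
    using hb unfolding integrand_eq value_eq .
qed

text \<open>The value is entry (j, i) of Es H H^H + N0 I, because the conjugate falls on index
  \<open>i\<close>; summed against \<open>K $$ (i, j)\<close> it therefore yields a trace.\<close>

lemma has_bochner_integral_joint_yy:
  assumes ij: "i < m" "j < m"
  shows "has_bochner_integral (joint_xy H Es N0) (\<lambda>w. cnj (snd w i) * snd w j)
    (complex_of_real Es * (\<Sum>k<n. cnj (H $$ (i, k)) * H $$ (j, k)) + (if i = j then complex_of_real N0 else 0))"
proof (rule has_bochner_integral_joint_xyI[OF Es N0], unfold dim_H)
  show "(\<lambda>w. cnj (snd w i) * snd w j) \<in> borel_measurable (Cspace n \<Otimes>\<^sub>M Cspace m)"
    using ij by (intro borel_measurable_times borel_measurable_cnj borel_measurable_snd_component)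
  \<comment> \<open>The four lines are signal-signal, the two mixed terms, and noise-noise; the
    mixed terms vanish because signal and noise are independent with mean 0.\<close>
  have hb: "has_bochner_integral (prior n Es \<Otimes>\<^sub>M prior m N0)
    (\<lambda>p. (\<Sum>k<n. \<Sum>l<n. cnj (H $$ (i, k)) * H $$ (j, l) * ((cnj (fst p k) * fst p l) * 1))
      + (\<Sum>k<n. cnj (H $$ (i, k)) * (cnj (fst p k) * snd p j))
      + (\<Sum>l<n. H $$ (j, l) * (fst p l * cnj (snd p i)))
      + 1 * (cnj (snd p i) * snd p j))
    ((\<Sum>k<n. \<Sum>l<n. cnj (H $$ (i, k)) * H $$ (j, l) * ((if k = l then complex_of_real Es else 0) * 1))
      + (\<Sum>k<n. cnj (H $$ (i, k)) * (cnj 0 * 0))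
      + (\<Sum>l<n. H $$ (j, l) * (0 * cnj 0))
      + 1 * (if i = j then complex_of_real N0 else 0))"
    using ij by (intro has_bochner_integral_add has_bochner_integral_sum has_bochner_integral_mult_right
      pair_moment has_bochner_integral_prior_covariance has_bochner_integral_prior_one
      has_bochner_integral_prior_mean has_bochner_integral_cnj Es N0) auto
  have value_eq: "(\<Sum>k<n. \<Sum>l<n. cnj (H $$ (i, k)) * H $$ (j, l) * ((if k = l then complex_of_real Es else 0) * 1))
      + (\<Sum>k<n. cnj (H $$ (i, k)) * (cnj 0 * 0)) + (\<Sum>l<n. H $$ (j, l) * (0 * cnj 0))
      + 1 * (if i = j then complex_of_real N0 else 0) =
    complex_of_real Es * (\<Sum>k<n. cnj (H $$ (i, k)) * H $$ (j, k)) + (if i = j then complex_of_real N0 else 0)"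
    by (simp add: if_distrib[of "\<lambda>x. _ * x"] sum_distrib_left mult_ac cong: if_cong)
  have integrand_eq: "(\<Sum>k<n. \<Sum>l<n. cnj (H $$ (i, k)) * H $$ (j, l) * ((cnj (fst p k) * fst p l) * 1))
      + (\<Sum>k<n. cnj (H $$ (i, k)) * (cnj (fst p k) * snd p j))
      + (\<Sum>l<n. H $$ (j, l) * (fst p l * cnj (snd p i)))
      + 1 * (cnj (snd p i) * snd p j) =
    cnj (snd (fst p, channel H (fst p) (snd p)) i) * snd (fst p, channel H (fst p) (snd p)) j"
    for p :: "(nat \<Rightarrow> complex) \<times> (nat \<Rightarrow> complex)"
  proof -
    have "(\<Sum>k<n. \<Sum>l<n. cnj (H $$ (i, k)) * H $$ (j, l) * ((cnj (fst p k) * fst p l) * 1)) =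
      cnj (\<Sum>k<n. H $$ (i, k) * fst p k) * (\<Sum>l<n. H $$ (j, l) * fst p l)"
      unfolding cnj_sum sum_product by (intro sum.cong refl) simp
    moreover have "(\<Sum>k<n. cnj (H $$ (i, k)) * (cnj (fst p k) * snd p j)) =
      cnj (\<Sum>k<n. H $$ (i, k) * fst p k) * snd p j"
      by (simp add: sum_distrib_right mult.assoc)
    moreover have "(\<Sum>l<n. H $$ (j, l) * (fst p l * cnj (snd p i))) =
      (\<Sum>l<n. H $$ (j, l) * fst p l) * cnj (snd p i)"
      by (simp add: sum_distrib_right mult.assoc)
    ultimately show ?thesis
      using ij by (simp add: channel_def dim_H ring_distribs mult_ac del: cnj_sum)
  qed
  show "has_bochner_integral (prior n Es \<Otimes>\<^sub>M prior m N0)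
      (\<lambda>p. cnj (snd (fst p, channel H (fst p) (snd p)) i) * snd (fst p, channel H (fst p) (snd p)) j)
      (complex_of_real Es * (\<Sum>k<n. cnj (H $$ (i, k)) * H $$ (j, k)) + (if i = j then complex_of_real N0 else 0))"
    using hb unfolding integrand_eq value_eq .
qed

lemma has_bochner_integral_sesq_xx:
  assumes G: "G \<in> carrier_mat n n"
  shows "has_bochner_integral (joint_xy H Es N0) (\<lambda>w. sesq G (fst w) (fst w)) (complex_of_real Es * mtrace G)"
proof -
  have "(\<Sum>i<n. \<Sum>j<n. G $$ (i, j) * (if i = j then complex_of_real Es else 0)) = complex_of_real Es * mtrace G"
    using G by (simp add: mtrace_def sum_distrib_left mult.commute if_distrib[of "\<lambda>x. _ * x"] cong: if_cong)
  with has_bochner_integral_sesq[where f = fst and g = fst, OF G has_bochner_integral_joint_xx] show ?thesis by simp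
qed

lemma has_bochner_integral_sesq_yx:
  assumes F: "F \<in> carrier_mat m n"
  shows "has_bochner_integral (joint_xy H Es N0) (\<lambda>w. sesq F (snd w) (fst w))
    (complex_of_real Es * mtrace (mat_adjoint H * F))"
proof -
  have "(\<Sum>i<m. \<Sum>j<n. F $$ (i, j) * (complex_of_real Es * cnj (H $$ (i, j)))) =
    complex_of_real Es * mtrace (mat_adjoint H * F)"
    using F H by (subst sum.swap)
      (simp add: mtrace_mult index_mat_adjoint sum_distrib_left mult_ac del: index_mult_mat(1))
  with has_bochner_integral_sesq[where f = snd and g = fst, OF F has_bochner_integral_joint_yx] show ?thesis by simp
qed

text \<open>Cyclicity places H^H and H around \<open>K\<close> in the signal part, so that for
  \<open>K\<close> of the form F C^-1 F^H both outer products become G. The white noise sees only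
  the trace of \<open>K\<close>.\<close>

lemma has_bochner_integral_sesq_yy:
  assumes K: "K \<in> carrier_mat m m"
  shows "has_bochner_integral (joint_xy H Es N0) (\<lambda>w. sesq K (snd w) (snd w))
    (complex_of_real Es * mtrace (mat_adjoint H * K * H) + complex_of_real N0 * mtrace K)"
proof -
  let ?R = "\<lambda>i j. complex_of_real Es * (\<Sum>k<n. cnj (H $$ (i, k)) * H $$ (j, k)) + (if i = j then complex_of_real N0 else 0)"
  have HH: "(H * mat_adjoint H) $$ (j, i) = (\<Sum>k<n. cnj (H $$ (i, k)) * H $$ (j, k))" if "i < m" "j < m" for i j
    using H that by (simp add: index_mult_mat_sum index_mat_adjoint mult.commute del: index_mult_mat(1))
  have "mtrace (mat_adjoint H * K * H) = mtrace (K * (H * mat_adjoint H))"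
  proof -
    have "mat_adjoint H * K * H = mat_adjoint H * (K * H)"
      using H K by (intro assoc_mult_mat) auto
    moreover have "mtrace (mat_adjoint H * (K * H)) = mtrace (K * H * mat_adjoint H)"
      using H K by (intro mtrace_mult_commute) auto
    moreover have "K * H * mat_adjoint H = K * (H * mat_adjoint H)"
      using H K by (intro assoc_mult_mat) auto
    ultimately show ?thesis by simp
  qed
  also have "\<dots> = (\<Sum>i<m. \<Sum>j<m. K $$ (i, j) * (\<Sum>k<n. cnj (H $$ (i, k)) * H $$ (j, k)))"
    using H K by (simp add: mtrace_mult HH del: index_mult_mat(1))
  finally have "(\<Sum>i<m. \<Sum>j<m. K $$ (i, j) * ?R i j) =
    complex_of_real Es * mtrace (mat_adjoint H * K * H) + complex_of_real N0 * mtrace K"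
    using K by (simp add: ring_distribs sum.distrib mtrace_def sum_distrib_left mult_ac
      if_distrib[of "\<lambda>x. _ * x"] cong: if_cong del: index_mult_mat(1))
  with has_bochner_integral_sesq[where f = snd and g = snd, OF K has_bochner_integral_joint_yy] show ?thesis by simp
qed

section \<open>Expected logarithms of the mismatched model\<close>

lemma expectation_ln_pp_cond:
  assumes F: "F \<in> carrier_mat m n" and G: "G \<in> carrier_mat n n"
  shows "(\<integral>w. ln (pp_cond F G (snd w) (fst w)) \<partial>joint_xy H Es N0) =
    Re (complex_of_real (2 * Es) * mtrace (mat_adjoint H * F) - complex_of_real Es * mtrace G)"
proof -
  have "has_bochner_integral (joint_xy H Es N0)
    (\<lambda>w. Re (2 * sesq F (snd w) (fst w) - sesq G (fst w) (fst w)))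
    (Re (2 * (complex_of_real Es * mtrace (mat_adjoint H * F)) - complex_of_real Es * mtrace G))"
    by (intro has_bochner_integral_Re has_bochner_integral_diff has_bochner_integral_mult_right
      has_bochner_integral_sesq_yx has_bochner_integral_sesq_xx F G)
  then show ?thesis
    by (simp add: has_bochner_integral_iff pp_cond_def)
qed

lemma expectation_ln_pp_marg:
  assumes p: "p > 0" and K: "K \<in> carrier_mat m m"
    and marg: "\<And>y. pp_marg F G Es y = exp (Es * Re (sesq K y y)) / p"
  shows "(\<integral>y. ln (pp_marg F G Es y) \<partial>distr (joint_xy H Es N0) (Cspace m) snd) =
    Es * Re (complex_of_real Es * mtrace (mat_adjoint H * K * H) + complex_of_real N0 * mtrace K) - ln p"
proof -
  have eq: "ln (pp_marg F G Es y) = Es * Re (sesq K y y) - ln p" for y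
    using p by (simp add: marg ln_div)
  have meas: "(\<lambda>y. Es * Re (sesq K y y) - ln p) \<in> borel_measurable (Cspace m)"
    unfolding sesq_def using K
    by (intro borel_measurable_diff borel_measurable_times borel_measurable_const borel_measurable_sum
      measurable_compose[OF _ borel_measurable_Re] borel_measurable_cnj measurable_Cspace_component) auto
  have snd: "snd \<in> joint_xy H Es N0 \<rightarrow>\<^sub>M Cspace m"
    unfolding joint_xy_def dim_H by simp
  \<comment> \<open>The constant \<open>ln p\<close> survives unchanged only because the joint law
    has total mass 1.\<close>
  have one: "has_bochner_integral (joint_xy H Es N0) (\<lambda>_. 1 :: real) 1"
    using has_bochner_integral_Re[OF has_bochner_integral_joint_one] by simp
  have "has_bochner_integral (joint_xy H Es N0) (\<lambda>w. Es * Re (sesq K (snd w) (snd w)) - ln p * 1)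
    (Es * Re (complex_of_real Es * mtrace (mat_adjoint H * K * H) + complex_of_real N0 * mtrace K) - ln p * 1)"
    by (intro has_bochner_integral_diff has_bochner_integral_mult_right has_bochner_integral_Re
      has_bochner_integral_sesq_yy K one)
  then show ?thesis
    unfolding eq using meas snd by (subst integral_distr) (auto simp: has_bochner_integral_iff)
qed

end

lemma smult_smult_mat: "a \<cdot>\<^sub>m (b \<cdot>\<^sub>m A) = (a * b) \<cdot>\<^sub>m (A :: complex mat)"
  by (intro eq_matI) auto

text \<open>Conjugating tr (A B) gives tr (B A), which is tr (A B) by cyclicity, although A B itself
  need not be Hermitian.\<close>

lemma mtrace_hermitian_mult_real:
  assumes A: "A \<in> carrier_mat n n" "mat_adjoint A = A" and B: "B \<in> carrier_mat n n" "mat_adjoint B = B"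
  shows "mtrace (A * B) \<in> \<real>"
proof -
  have "cnj (mtrace (A * B)) = mtrace (mat_adjoint (A * B))"
    using A B by (subst mtrace_adjoint) auto
  also have "\<dots> = mtrace (B * A)"
    using A B by (subst mat_adjoint_mult) auto
  also have "\<dots> = mtrace (A * B)"
    using A B by (intro mtrace_mult_commute) auto
  finally show ?thesis by (simp add: Reals_cnj_iff)
qed

section \<open>The information rate\<close>

theorem theorem1:
  fixes H Q L :: "complex mat" and Nr Nt \<nu> :: nat and Es N0 \<beta> :: real
  assumes "H \<in> carrier_mat Nr Nt"
    and "Nr \<ge> Nt" and "Nt \<ge> 2"
    and "vec_space.rank Nr H = Nt"
    and "thin_QL H Q L"
    and "1 \<le> \<nu>" and "\<nu> \<le> Nt - 1"
    and "Es > 0" and "N0 > 0"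
    and "\<beta> = Es / N0"
  shows "complex_of_real (I_LB_WLD H Q L \<nu> Es N0) =
     Ln (Determinant.det (1\<^sub>m Nt + complex_of_real \<beta> \<cdot>\<^sub>m (mat_adjoint (L_p \<nu> L) * L_p \<nu> L)))
     - mtrace ((1\<^sub>m Nt - W_p \<nu> L * mat_adjoint (W_p \<nu> L))
               * minv (1\<^sub>m Nt + complex_of_real \<beta> \<cdot>\<^sub>m (L_p \<nu> L * mat_adjoint (L_p \<nu> L))))"
proof -
  note H = assms(1) and Es = assms(8) and N0 = assms(9) and \<beta> = assms(10)
  have Q: "Q \<in> carrier_mat Nr Nt" and L: "L \<in> carrier_mat Nt Nt"
    and QQ: "mat_adjoint Q * Q = 1\<^sub>m Nt" and HQL: "H = Q * L"
    and lower: "lower_triangular L" and diag: "\<And>i. i < Nt \<Longrightarrow> L $$ (i, i) \<noteq> 0"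
  proof -
    have dimH: "dim_row H = Nr" "dim_col H = Nt" using H by auto
    note QL = assms(5)[unfolded thin_QL_def dimH]
    from QL show "Q \<in> carrier_mat Nr Nt" "L \<in> carrier_mat Nt Nt" "mat_adjoint Q * Q = 1\<^sub>m Nt"
      "H = Q * L" "lower_triangular L"
      by simp_all
    from QL have "\<forall>i<Nt. Re (L $$ (i, i)) > 0" by blast
    then show "L $$ (i, i) \<noteq> 0" if "i < Nt" for i
      using that by fastforce
  qed
  have \<beta>_nonneg: "\<beta> \<ge> 0" using Es N0 by (simp add: \<beta>)
  define W where "W = W_p \<nu> L"
  define X where "X = L_p \<nu> L"
  define V where "V = W * mat_adjoint W"
  define F where "F = F_p N0 \<nu> Q L"
  define G where "G = G_p N0 \<nu> L"
  define c where "c = complex_of_real (1 / N0)"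
  define e where "e = complex_of_real Es"
  have W: "W \<in> carrier_mat Nt Nt" and trV: "mtrace V = of_nat Nt"
    using W_p_gram[OF L _ lower diag] assms(7) by (auto simp: W_def V_def)
  have XWL: "X = W * L" by (simp add: X_def L_p_def W_def)
  have X: "X \<in> carrier_mat Nt Nt" using W L by (simp add: XWL)
  have dims[simp]: "dim_row Q = Nr" "dim_col Q = Nt" "dim_row L = Nt" "dim_col L = Nt"
    "dim_row W = Nt" "dim_col W = Nt" "dim_row X = Nt" "dim_col X = Nt" "dim_row H = Nr" "dim_col H = Nt"
    using Q L W X H by auto
  have V: "V \<in> carrier_mat Nt Nt" by (simp add: V_def carrier_matI)
  have F_eq: "F = c \<cdot>\<^sub>m (Q * (mat_adjoint W * X))"
    by (simp add: F_def F_p_def c_def W_def[symmetric] X_def[symmetric] assoc_mult_mat_dim)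
  have G_eq: "G = c \<cdot>\<^sub>m (mat_adjoint X * X)"
    by (simp add: G_def G_p_def c_def X_def[symmetric])
  have dimsFG[simp]: "dim_row F = Nr" "dim_col F = Nt" "dim_row G = Nt" "dim_col G = Nt"
    by (simp_all add: F_eq G_eq)
  have F: "F \<in> carrier_mat Nr Nt" and G: "G \<in> carrier_mat Nt Nt"
    by (simp_all add: carrier_matI)
  have cnj_c: "cnj c = c" by (simp add: c_def)
  \<comment> \<open>Q has orthonormal columns but need not be square, so only Q^H Q cancels; the
    trailing \<open>Z\<close> lets the rule act on products associated to the right.\<close>
  have QQZ: "mat_adjoint Q * (Q * Z) = Z" if "dim_row Z = Nt" for Z
    using that QQ left_mult_one_mat'[of Z] by (simp add: assoc_mult_mat_dim[symmetric])
  have HF: "mat_adjoint H * F = G"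
    by (simp add: HQL XWL F_eq G_eq mat_adjoint_mult mult_smult_mat_dim assoc_mult_mat_dim QQZ)
  have G_adj: "mat_adjoint G = G"
    by (simp add: G_eq mat_adjoint_smult mat_adjoint_mult cnj_c)
  have FH: "mat_adjoint F * H = G"
    using arg_cong[OF HF, of mat_adjoint] by (simp add: mat_adjoint_mult G_adj)
  \<comment> \<open>Unlike in H^H F, cancelling Q^H Q here leaves W W^H in the middle; this is where
    \<open>V\<close> comes in.\<close>
  have FF: "mat_adjoint F * F = (c * c) \<cdot>\<^sub>m (mat_adjoint X * V * X)"
    by (simp add: F_eq V_def mat_adjoint_smult mat_adjoint_mult mult_smult_mat_dim smult_mult_mat_dim
        assoc_mult_mat_dim QQZ cnj_c smult_smult_mat)
  define C where "C = 1\<^sub>m Nt + complex_of_real \<beta> \<cdot>\<^sub>m (mat_adjoint X * X)"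
  define D where "D = 1\<^sub>m Nt + complex_of_real \<beta> \<cdot>\<^sub>m (X * mat_adjoint X)"
  have C_eq: "C = 1\<^sub>m Nt + e \<cdot>\<^sub>m G"
    by (simp add: C_def G_eq e_def c_def \<beta> smult_smult_mat)
  have C: "C \<in> carrier_mat Nt Nt" and D: "D \<in> carrier_mat Nt Nt"
    by (simp_all add: C_def D_def carrier_matI)
  have detC: "Determinant.det C \<noteq> 0"
    using det_one_plus_gram[OF X \<beta>_nonneg] by (simp add: C_def)
  \<comment> \<open>The Gram lemma is applied to X^H, whose own adjoint is X.\<close>
  have detD: "Determinant.det D \<noteq> 0"
    using det_one_plus_gram[OF mat_adjoint_carrier[OF X] \<beta>_nonneg] by (simp add: D_def)
  define K where "K = minv C"
  note K = minv_correct[OF C detC, folded K_def]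
  have dimsK[simp]: "dim_row K = Nt" "dim_col K = Nt" using K(3) by auto
  define B where "B = F * K * mat_adjoint F"
  have B: "B \<in> carrier_mat Nr Nr" by (simp add: B_def carrier_matI)
  \<comment> \<open>The same \<open>d\<close> yields the marginal and det C, so \<open>ln p\<close>
    will be the log-determinant.\<close>
  obtain d T where
    d: "\<And>k. k < Nt \<Longrightarrow> d k > (0 :: real)" and T1: "\<And>k. k < Nt \<Longrightarrow> T k k = 1"
    and T0: "\<And>k j. k < Nt \<Longrightarrow> k < j \<Longrightarrow> T k j = 0"
    and ldl: "\<And>i j. i < Nt \<Longrightarrow> j < Nt \<Longrightarrow> C $$ (i, j) = (\<Sum>k<Nt. cnj (T k i) * complex_of_real (d k) * T k j)"
    and det: "Determinant.det C = complex_of_real (\<Prod>k<Nt. d k)"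
    by (rule ldl_one_plus_gram[OF X \<beta>_nonneg, folded C_def]) (rule that, assumption+)
  define p where "p = (\<Prod>k<Nt. d k)"
  have p: "p > 0" unfolding p_def using d by (intro prod_pos) auto
  have marg: "pp_marg F G Es y = exp (Es * Re (sesq B y y)) / p" for y
    unfolding B_def p_def
    by (rule pp_marg_eq[OF Es F G, of d T])
      (use d T1 T0 ldl K in \<open>simp_all add: C_eq[unfolded e_def]\<close>)
  have "I_LB_WLD H Q L \<nu> Es N0 =
    Re (complex_of_real (2 * Es) * mtrace (mat_adjoint H * F) - complex_of_real Es * mtrace G)
    - (Es * Re (complex_of_real Es * mtrace (mat_adjoint H * B * H) + complex_of_real N0 * mtrace B) - ln p)"
    unfolding I_LB_WLD_def Let_def F_def[symmetric] G_def[symmetric] dims(9)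
    by (simp only: expectation_ln_pp_cond[OF H Es N0 F G] expectation_ln_pp_marg[OF H Es N0 p B marg])
  \<comment> \<open>The cross term contributes 2 Es tr G by H^H F = G, and the quadratic term takes
    away Es tr G.\<close>
  also have "\<dots> = Re (e * mtrace G - e * (e * mtrace (mat_adjoint H * B * H))
    - e * complex_of_real N0 * mtrace B + complex_of_real (ln p))"
    unfolding HF by (simp add: e_def algebra_simps)
  also have "mat_adjoint H * B * H = G * (K * G)"
  proof -
    have "mat_adjoint H * B * H = (mat_adjoint H * F) * (K * (mat_adjoint F * H))"
      by (simp add: B_def assoc_mult_mat_dim)
    then show ?thesis by (simp add: HF FH)
  qed
  also have "mtrace B = c * c * mtrace (K * (mat_adjoint X * V * X))"
  proof -
    have "mtrace B = mtrace (K * (mat_adjoint F * F))"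
      using mtrace_mult_commute[of F "K * mat_adjoint F"] by (simp add: B_def assoc_mult_mat_dim)
    then show ?thesis
      using V by (simp add: FF mult_smult_mat_dim mtrace_smult)
  qed
  \<comment> \<open>From K C = 1 one gets e K G = 1 - K; using this twice removes both factors of G.
    The surviving e tr G cancels the one from the conditional term.\<close>
  also have "e * (e * mtrace (G * (K * G))) = e * mtrace G - of_nat Nt + mtrace K"
  proof -
    have KC: "K + e \<cdot>\<^sub>m (K * G) = 1\<^sub>m Nt"
      using K(2) right_mult_one_mat[OF K(3)] by (simp add: C_eq mult_add_mat_dim mult_smult_mat_dim)
    have 1: "mtrace K + e * mtrace (K * G) = of_nat Nt"
      using arg_cong[OF KC, of mtrace] by (simp add: mtrace_add mtrace_smult mtrace_one)
    have "G * K + e \<cdot>\<^sub>m (G * (K * G)) = G"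
      using arg_cong[OF KC, of "\<lambda>Z. G * Z"] right_mult_one_mat[OF G]
      by (simp add: mult_add_mat_dim mult_smult_mat_dim)
    from arg_cong[OF this, of mtrace] have "mtrace (G * K) + e * mtrace (G * (K * G)) = mtrace G"
      by (simp add: mtrace_add mtrace_smult)
    moreover have "mtrace (G * K) = mtrace (K * G)"
      by (rule mtrace_mult_commute) simp_all
    ultimately have "e * mtrace (G * (K * G)) = mtrace G - mtrace (K * G)"
      by (simp add: algebra_simps)
    then have "e * (e * mtrace (G * (K * G))) = e * mtrace G - e * mtrace (K * G)"
      by (simp only: right_diff_distrib)
    then show ?thesis unfolding 1[symmetric] by simp
  qed
  also have "e * mtrace G - (e * mtrace G - of_nat Nt + mtrace K)
      - e * complex_of_real N0 * (c * c * mtrace (K * (mat_adjoint X * V * X))) + complex_of_real (ln p)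
    = complex_of_real (ln p) - mtrace ((1\<^sub>m Nt - V) * minv D)"
  proof -
    \<comment> \<open>Es N0 / N0^2 = Es / N0: the two factors 1 / N0 come from F^H F, the factor N0
      from the noise variance.\<close>
    have "e * complex_of_real N0 * (c * c) = complex_of_real \<beta>"
      using N0 by (simp add: e_def c_def \<beta>)
    then have "e * complex_of_real N0 * (c * c * z) = complex_of_real \<beta> * z" for z
      by (metis mult.assoc)
    then show ?thesis
      using mtrace_one_minus_gram_minv[OF X V trV C_def detC D_def detD]
      by (simp add: K_def)
  qed
  finally have "I_LB_WLD H Q L \<nu> Es N0 = Re (complex_of_real (ln p) - mtrace ((1\<^sub>m Nt - V) * minv D))" .
  \<comment> \<open>The computation so far determines only a real part; reality of the trace
    upgrades it to a complex equation.\<close>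
  moreover have "mtrace ((1\<^sub>m Nt - V) * minv D) \<in> \<real>"
  proof (rule mtrace_hermitian_mult_real)
    show "mat_adjoint (1\<^sub>m Nt - V) = 1\<^sub>m Nt - V"
      using V by (simp add: mat_adjoint_minus V_def mat_adjoint_mult)
    have "mat_adjoint D = D"
      by (simp add: D_def mat_adjoint_add mat_adjoint_smult mat_adjoint_mult)
    then show "mat_adjoint (minv D) = minv D"
      by (rule adjoint_minv_hermitian[OF D detD])
  qed (use V minv_correct(3)[OF D detD] in auto)
  ultimately have "complex_of_real (I_LB_WLD H Q L \<nu> Es N0) =
    complex_of_real (ln p) - mtrace ((1\<^sub>m Nt - V) * minv D)"
    by (simp add: of_real_Re)
  \<comment> \<open>Since det C = p > 0, the principal logarithm is the real one.\<close>
  also have "complex_of_real (ln p) = Ln (Determinant.det C)"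
    using p by (simp add: det p_def[symmetric] Ln_of_real)
  finally show ?thesis
    by (simp add: C_def D_def V_def W_def X_def)
qed

end
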